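(* Let $P$ be a full-dimensional simplicial polytope in $\mathbb{R}^d$ with vertices $x_1,\ldots,x_n$, $x_k=(x_{k1},\ldots,x_{kd})$, where $n\ge d+2$, let $\mu_P$ be the uniform probability distribution on $P$ with moments $m_{i_1\cdots i_d}$, and let $\Sigma$ be any triangulation of $P$ that uses only these vertices. Then the normalized moment generating function of $\mu_P$ satisfies $$\sum_{i_1,\ldots,i_d\in\mathbb{N}}\frac{(i_1+\cdots+i_d+d)!}{i_1!\cdots i_d!\,d!}\,m_{i_1\cdots i_d}\,t_1^{i_1}\cdots t_d^{i_d}\;=\;\frac{1}{\mathrm{vol}(P)}\sum_{\sigma\in\Sigma}\frac{\mathrm{vol}(\sigma)}{\prod_{k\in\sigma}(1-x_{k1}t_1-x_{k2}t_2-\cdots-x_{kd}t_d)} .$$ The right-hand expression is independent of the triangulation $\Sigma$. Moreover, as the vertices vary locally without changing the combinatorial type of $P$, each moment $m_I=m_I(X)$, $I\in\mathbb{N}^d$, is a rational function of the $n\times d$ matrix $X=(x_{kl})$ whose numerator is a homogeneous polynomial of degree $|I|+d$ in $X$ and whose denominator equals $\mathrm{vol}(P)$, which is a homogeneous polynomial of degree $d$ in $X$.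
   Context: $\mathbb{N}=\{0,1,2,\ldots\}$ and $|I|=i_1+\cdots+i_d$. The moments of $\mu_P$ are $m_{i_1\cdots i_d}=\int_{\mathbb{R}^d}w_1^{i_1}\cdots w_d^{i_d}\,d\mu_P$. The triangulation $\Sigma$ is identified with the collection of the $(d+1)$-element subsets $\sigma=\{\sigma_0,\ldots,\sigma_d\}\subset\{1,\ldots,n\}$ indexing its maximal simplices $\mathrm{conv}(x_{\sigma_0},\ldots,x_{\sigma_d})$; $\mathrm{vol}(\sigma)$ is the volume of that simplex and $\mathrm{vol}(P)=\sum_{\sigma\in\Sigma}\mathrm{vol}(\sigma)$. The combinatorial type of $P$ is its face lattice (with vertices labeled by $1,\ldots,n$). *)

theory Defs
  imports "HOL-Analysis.Analysis"
begin

text \<open>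
  A configuration of points \<open>x\<^sub>1, \<dots>, x\<^sub>n\<close> in \<open>\<real>\<^sup>d\<close> is an \<open>n \<times> d\<close> matrix
  \<open>X :: real ^ 'd ^ 'n\<close> with \<open>d = CARD('d)\<close>, \<open>n = CARD('n)\<close> and \<open>x\<^sub>k = X $ k\<close>.
\<close>

definition conv_rows :: "real ^ 'd ^ 'n \<Rightarrow> 'n set \<Rightarrow> (real ^ 'd) set" where
  "conv_rows X \<sigma> = convex hull ((\<lambda>k. X $ k) ` \<sigma>)"

abbreviation vol :: "(real ^ 'd) set \<Rightarrow> real" where
  "vol S \<equiv> measure lborel S"

definition simplicial_polytope :: "'a::euclidean_space set \<Rightarrow> bool" where
  "simplicial_polytope P \<longleftrightarrow>
     polytope P \<and> (\<forall>F. F facet_of P \<longrightarrow> (aff_dim P - 1) simplex F)"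

text \<open>
  The constant \<open>triangulation\<close> is the library's: a finite set of simplices, any two of which meet in
  a common face.
\<close>

definition triangulates :: "real ^ 'd ^ 'n \<Rightarrow> 'n set set \<Rightarrow> (real ^ 'd) set \<Rightarrow> bool" where
  "triangulates X \<Sigma> P \<longleftrightarrow>
     (\<forall>\<sigma>\<in>\<Sigma>. card \<sigma> = CARD('d) + 1 \<and> int CARD('d) simplex conv_rows X \<sigma>) \<and>
     triangulation (conv_rows X ` \<Sigma>) \<and>
     \<Union> (conv_rows X ` \<Sigma>) = P"

definition moment :: "(real ^ 'd) set \<Rightarrow> ('d \<Rightarrow> nat) \<Rightarrow> real" where
  "moment P I = (\<integral>w. (\<Prod>l\<in>UNIV. (w $ l) ^ I l) \<partial>uniform_measure lborel P)"

definition normalized_mgf_term :: "(real ^ 'd) set \<Rightarrow> real ^ 'd \<Rightarrow> ('d \<Rightarrow> nat) \<Rightarrow> real" where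
  "normalized_mgf_term P t I =
     fact ((\<Sum>l\<in>UNIV. I l) + CARD('d)) / ((\<Prod>l\<in>UNIV. fact (I l)) * fact CARD('d))
       * moment P I * (\<Prod>l\<in>UNIV. (t $ l) ^ I l)"

definition triangulation_sum ::
    "real ^ 'd ^ 'n \<Rightarrow> 'n set set \<Rightarrow> (real ^ 'd) set \<Rightarrow> real ^ 'd \<Rightarrow> real" where
  "triangulation_sum X \<Sigma> P t =
     1 / vol P * (\<Sum>\<sigma>\<in>\<Sigma>. vol (conv_rows X \<sigma>) / (\<Prod>k\<in>\<sigma>. 1 - (\<Sum>l\<in>UNIV. X $ k $ l * t $ l)))"

text \<open>
  The face lattice of the convex hull of all rows, each face being recorded as the set of labels
  of the rows it contains. The order is inclusion, so two configurations have isomorphic face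
  lattices, compatibly with the labels, exactly if these families of label sets are equal.
\<close>

definition labeled_face_lattice :: "real ^ 'd ^ 'n \<Rightarrow> 'n set set" where
  "labeled_face_lattice X = {{k. X $ k \<in> F} | F. F face_of conv_rows X UNIV}"

text \<open>
  The summation range consists of the exponent matrices of total degree \<open>m\<close>; it is finite
  because the index types are.
\<close>

definition homogeneous_polynomial ::
    "nat \<Rightarrow> (real ^ 'd ^ 'n \<Rightarrow> real) \<Rightarrow> bool" where
  "homogeneous_polynomial m f \<longleftrightarrow>
     (\<exists>c :: ('n \<Rightarrow> 'd \<Rightarrow> nat) \<Rightarrow> real. \<forall>X.
        f X = (\<Sum>a \<in> {a. (\<Sum>k\<in>UNIV. \<Sum>l\<in>UNIV. a k l) = m}.
                 c a * (\<Prod>k\<in>UNIV. \<Prod>l\<in>UNIV. (X $ k $ l) ^ a k l)))"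

end

theory Submission
  imports Defs "HOL-Computational_Algebra.Polynomial"
begin

text \<open>
  Expanding \<open>(1 - w \<bullet> t)\<^bsup>-(d+1)\<^esup>\<close> as a power series and integrating term by term turns the
  generating function into the integral of this kernel over \<open>P\<close>. On a simplex the kernel is the
  Jacobian determinant of the projective map \<open>w \<mapsto> w / (1 - w \<bullet> t)\<close>, which sends the simplex to another
  simplex; comparing the two volumes gives the product formula. For the rationality statement, cone
  the simplicial facets off from the centroid \<open>c\<close>: the integral of a monomial over a cone is the absolute
  value of a determinant in the differences \<open>x\<^sub>k - c\<close> times an integral over the standard simplex that is
  polynomial in the vertices. The facets can be read off the face lattice and the signs of the
  determinants are locally constant.
\<close>

text \<open>The exponent d + 1 is forced from two sides: its binomial series has the coefficients (m
  + d)!/(m! d!) of the normalization, and it is the power for which the kernel is a Jacobian. The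
  series needs |w \<bullet> t| < 1 on P, so it reaches small t only; agreement of two triangulations
  at every t off the poles is a separate argument.

  For the moments the apex of the cones must be interior for every full-dimensional configuration
  and have coordinates that are linear forms in X, so that the determinants keep degree d and the
  integrated monomials degree |I|. The centroid of the vertices has both properties. The
  neighbourhood of X consists of the configurations at which the determinants have the same signs as
  at X. Inside it the nonzero determinants also force full dimension, and this is what allows an
  equal face lattice to be turned into equal facets, hence into the same polynomials for all these
  configurations. The volume is the numerator for I = 0, so a single construction yields numerators
  and denominator.\<close>

section \<open>Relabelling coordinates\<close>

text \<open>
  The library's change of variables formula needs a well-ordered index type. A copy of the
  index type carries such an order, and relabelling coordinates preserves Lebesgue measure.
\<close>

typedef 'a wo = "{..<CARD('a::finite)}"
  by (rule exI[of _ 0]) simp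

instance wo :: (finite) finite
proof
  have "inj_on Rep_wo (UNIV :: 'a wo set)"
    by (simp add: inj_on_def Rep_wo_inject)
  moreover have "finite (range (Rep_wo :: 'a wo \<Rightarrow> nat))"
    by (rule finite_subset[of _ "{..<CARD('a)}"]) (use Rep_wo in auto)
  ultimately show "finite (UNIV :: 'a wo set)"
    by (rule finite_imageD[rotated])
qed

instantiation wo :: (finite) wellorder
begin

definition less_eq_wo :: "'a wo \<Rightarrow> 'a wo \<Rightarrow> bool" where
  "x \<le> y \<longleftrightarrow> Rep_wo x \<le> Rep_wo y"

definition less_wo :: "'a wo \<Rightarrow> 'a wo \<Rightarrow> bool" where
  "x < y \<longleftrightarrow> Rep_wo x < Rep_wo y"

instance
proof
  fix P :: "'a wo \<Rightarrow> bool" and a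
  assume *: "\<And>x. (\<And>y. y < x \<Longrightarrow> P y) \<Longrightarrow> P x"
  show "P a"
    by (induction a rule: measure_induct_rule[of Rep_wo]) (use * in \<open>auto simp: less_wo_def\<close>)
qed (auto simp: less_eq_wo_def less_wo_def Rep_wo_inject)

end

lemma card_wo [simp]: "CARD('a::finite wo) = CARD('a)"
  using type_definition.card[OF type_definition_wo] by simp

lemma ex_bij_wo: "\<exists>\<iota> :: 'a wo \<Rightarrow> 'a::finite. bij \<iota>"
  using finite_same_card_bij[of "UNIV :: 'a wo set" "UNIV :: 'a set"] by simp

text \<open>Lebesgue measure is determined by its values on boxes, and the preimage of a box is a
  box with the same side lengths in permuted order.\<close>

lemma lborel_relabel:
  fixes f :: "'b::finite \<Rightarrow> 'a::finite"
  assumes "bij f"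
  shows "distr lborel borel (\<lambda>x :: real ^ 'a. \<chi> i. x $ f i) = lborel"
proof (rule lborel_eqI[symmetric])
  let ?T = "\<lambda>x :: real ^ 'a. \<chi> i. x $ f i"
  have meas: "?T \<in> borel_measurable borel"
    by (intro borel_measurable_continuous_onI continuous_intros)
  fix l u :: "real ^ 'b"
  assume le: "\<And>b. b \<in> Basis \<Longrightarrow> l \<bullet> b \<le> u \<bullet> b"
  define g where "g = inv f"
  have fg: "f (g j) = j" and gf: "g (f i) = i" for i j
    using assms by (auto simp: g_def bij_def surj_f_inv_f)
  have bg: "bij g" using assms by (simp add: g_def bij_imp_bij_inv)
  have le': "l $ i \<le> u $ i" for i
    using le[of "axis i 1"] by (simp add: inner_axis axis_in_Basis_iff)
  let ?l = "\<chi> j. l $ g j" and ?u = "\<chi> j. u $ g j"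
  have eq: "?T -` box l u = box ?l ?u"
    by (auto simp: mem_box_cart gf) (metis fg gf)+
  have "emeasure (distr lborel borel ?T) (box l u) = emeasure lborel (box ?l ?u)"
    using meas by (subst emeasure_distr) (auto simp: eq)
  also have "\<dots> = (\<Prod>b\<in>Basis. (?u - ?l) \<bullet> b)"
    using le' by (subst emeasure_lborel_box) (auto simp: Basis_vec_def inner_axis)
  also have "(\<Prod>b\<in>Basis. (?u - ?l) \<bullet> b) = (\<Prod>j\<in>UNIV. u $ g j - l $ g j)"
    by (simp add: Basis_vec_def UNION_singleton_eq_range prod.reindex inj_on_def axis_eq_axis inner_axis)
  also have "\<dots> = (\<Prod>i\<in>UNIV. u $ i - l $ i)"
    using prod.reindex_bij_betw[OF bg, of "\<lambda>i. u $ i - l $ i"] by simp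
  also have "\<dots> = (\<Prod>b\<in>Basis. (u - l) \<bullet> b)"
    by (simp add: Basis_vec_def UNION_singleton_eq_range prod.reindex inj_on_def axis_eq_axis inner_axis)
  finally show "emeasure (distr lborel borel ?T) (box l u) = (\<Prod>b\<in>Basis. (u - l) \<bullet> b)" .
qed simp

lemma set_integral_relabel:
  fixes f :: "'b::finite \<Rightarrow> 'a::finite" and h :: "real ^ 'b \<Rightarrow> real"
  assumes "bij f" "compact S" "continuous_on S h"
  shows "(LINT w:S|lborel. h w) = (LINT x:{x. (\<chi> i. x $ f i) \<in> S}|lborel. h (\<chi> i. x $ f i))"
proof -
  let ?T = "\<lambda>x :: real ^ 'a. \<chi> i. x $ f i"
  have meas: "?T \<in> borel_measurable borel"
    by (intro borel_measurable_continuous_onI continuous_intros)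
  have "(LINT w:S|lborel. h w) = (LINT w:S|distr lborel borel ?T. h w)"
    by (simp add: lborel_relabel[OF assms(1)])
  also have "\<dots> = (LINT x|lborel. indicator S (?T x) *\<^sub>R h (?T x))"
    unfolding set_lebesgue_integral_def
    \<comment> \<open>Continuity of \<open>h\<close> is known on \<open>S\<close> only, so
      measurability is available for its product with the indicator, not for \<open>h\<close>
      alone.\<close>
    using meas borel_integrable_compact[OF assms(2,3), THEN borel_measurable_integrable]
    by (subst integral_distr) auto
  finally show ?thesis
    by (simp add: set_lebesgue_integral_def indicator_def)
qed

section \<open>Integrals over simplices\<close>

lemma absolutely_integrable_continuous_compact:
  fixes f :: "'a::euclidean_space \<Rightarrow> real"
  assumes "compact S" "continuous_on S f"
  shows "f absolutely_integrable_on S" "set_integrable lborel S f"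
proof -
  show *: "set_integrable lborel S f"
    unfolding set_integrable_def by (rule borel_integrable_compact[OF assms])
  then show "f absolutely_integrable_on S"
    unfolding set_integrable_def by (subst integrable_completion) auto
qed

lemma set_integral_eq_integral_compact:
  fixes f :: "'a::euclidean_space \<Rightarrow> real"
  assumes "compact S" "continuous_on S f"
  shows "(LINT x:S|lborel. f x) = integral S f"
  by (intro set_borel_integral_eq_integral absolutely_integrable_continuous_compact assms)

abbreviation std_simplex :: "'a::euclidean_space set" where
  "std_simplex \<equiv> convex hull (insert 0 Basis)"

lemma compact_std_simplex: "compact (std_simplex :: 'a::euclidean_space set)"
  by (intro finite_imp_compact_convex_hull) auto

lemma set_integral_linear_image:
  fixes f :: "real ^ 'n::{finite,wellorder} \<Rightarrow> real" and g :: "real ^ 'n::_ \<Rightarrow> real ^ 'n::_"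
  assumes "linear g" "compact S" "continuous_on (g ` S) f"
  shows "(LINT w:g ` S|lborel. f w) = \<bar>det (matrix g)\<bar> * (LINT x:S|lborel. f (g x))"
proof -
  have cg: "continuous_on S g"
    by (rule linear_continuous_on[OF linear_conv_bounded_linear[THEN iffD1, OF assms(1)]])
  have cgS: "compact (g ` S)" using cg assms(2) by (rule compact_continuous_image)
  have cfg: "continuous_on S (\<lambda>x. f (g x))"
    using continuous_on_compose[OF cg assms(3)] by (simp add: o_def)
  \<comment> \<open>The linear change of variables formula is applied to a vector-valued integrand,
    so \<open>f\<close> becomes a vector with one entry.\<close>
  let ?F = "\<lambda>x. vec (f x) :: real ^ 1"
  have "?F absolutely_integrable_on g ` S"
    using absolutely_integrable_continuous_compact(1)[OF cgS assms(3)]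
    by (simp add: absolutely_integrable_on_1_iff)
  then have "integral (g ` S) ?F = \<bar>det (matrix g)\<bar> *\<^sub>R integral S (?F \<circ> g)"
    using integral_change_of_variables_linear[OF assms(1)] by blast
  then have "integral (g ` S) ?F $ 1 = (\<bar>det (matrix g)\<bar> *\<^sub>R integral S (?F \<circ> g)) $ 1"
    by simp
  then have "integral (g ` S) f = \<bar>det (matrix g)\<bar> * integral S (\<lambda>x. f (g x))"
    by (simp add: integral_on_1_eq o_def)
  then show ?thesis
    using set_integral_eq_integral_compact[OF cgS assms(3)]
      set_integral_eq_integral_compact[OF assms(2) cfg] by simp
qed

lemma set_integral_translation:
  fixes f :: "'a::euclidean_space \<Rightarrow> real"
  assumes "compact S" "continuous_on ((+) p ` S) f"
  shows "(LINT w:(+) p ` S|lborel. f w) = (LINT x:S|lborel. f (p + x))"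
proof -
  have cS: "compact ((+) p ` S)" using assms(1) by (rule compact_translation)
  have "(LINT w:(+) p ` S|lborel. f w) = (LINT w:(+) p ` S|distr lborel borel ((+) p). f w)"
    by (simp add: lborel_distr_plus)
  also have "\<dots> = (LINT x|lborel. indicator ((+) p ` S) (p + x) *\<^sub>R f (p + x))"
    unfolding set_lebesgue_integral_def
    using borel_integrable_compact[OF cS assms(2), THEN borel_measurable_integrable]
    by (subst integral_distr) auto
  also have "\<dots> = (LINT x:S|lborel. f (p + x))"
    by (simp add: set_lebesgue_integral_def indicator_def image_iff)
  finally show ?thesis .
qed

lemma simplex_eq_affine_image:
  fixes p :: "real ^ 'n" and v :: "'n::_ \<Rightarrow> real ^ 'n::_"
  defines "g \<equiv> \<lambda>x. \<Sum>i\<in>UNIV. x $ i *\<^sub>R (v i - p)"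
  shows "linear g" "convex hull (insert p (range v)) = (+) p ` g ` std_simplex"
proof -
  show g: "linear g"
    unfolding g_def
    by (intro linearI) (simp_all add: scaleR_add_left sum.distrib scaleR_right.sum)
  have ax: "g (axis k 1) = v k - p" for k
  proof -
    have "g (axis k 1) = (\<Sum>i\<in>UNIV. if i = k then v k - p else 0)"
      unfolding g_def by (intro sum.cong) (auto simp: axis_def)
    then show ?thesis by simp
  qed
  have g0: "g 0 = 0" by (simp add: g_def)
  have "(+) p ` g ` std_simplex = convex hull ((+) p ` g ` insert 0 Basis)"
    by (simp only: convex_hull_linear_image[OF g] convex_hull_translation)
  also have "(+) p ` g ` insert 0 Basis = insert p (range v)"
    by (auto simp: Basis_vec_def g0 ax image_iff)
  finally show "convex hull (insert p (range v)) = (+) p ` g ` std_simplex" ..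
qed

lemma set_integral_simplex_wellorder:
  fixes p :: "real ^ 'n::{finite,wellorder}" and v :: "'n::_ \<Rightarrow> real ^ 'n::_"
  assumes "continuous_on (convex hull (insert p (range v))) f"
  shows "(LINT w:convex hull (insert p (range v))|lborel. f w) =
    \<bar>det (\<chi> i. v i - p)\<bar> * (LINT x:std_simplex|lborel. f (p + (\<Sum>i\<in>UNIV. x $ i *\<^sub>R (v i - p))))"
proof -
  define g where "g = (\<lambda>x. \<Sum>i\<in>UNIV. x $ i *\<^sub>R (v i - p))"
  note g = simplex_eq_affine_image(1)[of v p, folded g_def]
  note hull = simplex_eq_affine_image(2)[of p v, folded g_def]
  have cg: "continuous_on A g" for A
    by (rule linear_continuous_on[OF linear_conv_bounded_linear[THEN iffD1, OF g]])
  have "compact (g ` std_simplex)"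
    using cg compact_std_simplex by (rule compact_continuous_image)
  then have "(LINT w:convex hull (insert p (range v))|lborel. f w)
      = (LINT x:g ` std_simplex|lborel. f (p + x))"
    unfolding hull using assms by (intro set_integral_translation) (auto simp: hull)
  also have "\<dots> = \<bar>det (matrix g)\<bar> * (LINT x:std_simplex|lborel. f (p + g x))"
  proof (rule set_integral_linear_image[OF g compact_std_simplex])
    show "continuous_on (g ` std_simplex) (\<lambda>x. f (p + x))"
      by (rule continuous_on_compose2[OF assms]) (auto intro!: continuous_intros simp: hull)
  qed
  \<comment> \<open>\<open>g\<close> has the edges as columns, whereas the determinant in the
    statement has them as rows.\<close>
  also have "matrix g = transpose (\<chi> i. v i - p)"
  proof -
    have "g (axis j 1) $ i = (v j - p) $ i" for i j
    proof -
      have "g (axis j 1) = (\<Sum>i\<in>UNIV. if i = j then v j - p else 0)"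
        unfolding g_def by (intro sum.cong) (auto simp: axis_def)
      then show ?thesis by simp
    qed
    then show ?thesis by (simp add: matrix_def transpose_def vec_eq_iff)
  qed
  finally show ?thesis by (simp add: g_def det_transpose)
qed

lemma vol_simplex_wellorder:
  fixes p :: "real ^ 'n::{finite,wellorder}" and v :: "'n::_ \<Rightarrow> real ^ 'n::_"
  shows "vol (convex hull (insert p (range v))) = \<bar>det (\<chi> i. v i - p)\<bar> / fact CARD('n)"
proof -
  have "(LINT w:convex hull (insert p (range v))|lborel. 1::real) =
    \<bar>det (\<chi> i. v i - p)\<bar> * (LINT x:std_simplex|(lborel :: (real^'n::_) measure). 1)"
    by (rule set_integral_simplex_wellorder) simp
  then show ?thesis
    using content_std_simplex[where ?'a = "real^'n::_"] by (simp add: set_lebesgue_integral_def)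
qed

text \<open>Matrix determinant lemma. The rows of I + u v^T are introduced one at a time; by
  linearity in the current row j, each step adds the single term
  \<open>u $ j * v $ j\<close>.\<close>

lemma det_rank_one_update:
  fixes u v :: "real ^ 'n"
  shows "det (\<chi> i j. (if i = j then 1 else 0) + u $ i * v $ j) = 1 + (\<Sum>i\<in>UNIV. u $ i * v $ i)"
proof -
  define e where "e = (\<lambda>i. axis i 1 :: real ^ 'n)"
  define R where "R = (\<lambda>K i. if i \<in> K then e i + u $ i *s v else e i)"
  \<comment> \<open>Once row k is \<open>v\<close>, each multiple of \<open>v\<close> added to a row
    in \<open>K\<close> contributes a determinant with two equal rows. What is left is the identity
    with row k replaced by \<open>v\<close>.\<close>
  have aux: "det (\<chi> i. if i = k then v else R K i) = v $ k" if "finite K" "k \<notin> K" for k K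
    using that
  proof (induction K rule: finite_induct)
    case empty
    \<comment> \<open>With \<open>v\<close> expanded in the unit rows, Cramer's rule picks out its
      k-th coefficient.\<close>
    have v: "(\<Sum>i\<in>UNIV. v $ i *s row i (mat 1 :: real ^ 'n ^ 'n)) = v"
      by (simp add: vec_eq_iff row_def mat_def if_distrib if_distribR cong: if_cong)
    have R: "R {} i = row i (mat 1)" for i
      by (simp add: vec_eq_iff R_def e_def row_def mat_def axis_def)
    have "det (\<chi> i. if i = k then v else R {} i) =
       det (\<chi> i. if i = k then \<Sum>i\<in>UNIV. v $ i *s row i (mat 1 :: real ^ 'n ^ 'n) else row i (mat 1))"
      unfolding v R ..
    also have "\<dots> = v $ k"
      by (subst cramer_lemma_transpose) simp
    finally show ?case .
  next
    case (insert j K)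
    then have jk: "j \<noteq> k" by auto
    let ?c = "\<lambda>i. if i = k then v else R K i"
    have "det (\<chi> i. if i = k then v else R (insert j K) i)
        = det (\<chi> i. if i = j then e j + u $ j *s v else ?c i)"
      using jk insert.hyps by (intro arg_cong[where f = det]) (auto simp: vec_eq_iff R_def)
    also have "\<dots> = det (\<chi> i. if i = j then e j else ?c i) + det (\<chi> i. if i = j then u $ j *s v else ?c i)"
      by (rule det_row_add)
    also have "det (\<chi> i. if i = j then u $ j *s v else ?c i)
      = u $ j * det (\<chi> i. if i = j then v else ?c i)"
      by (rule det_row_mul)
    also have "det (\<chi> i. if i = j then v else ?c i) = 0"
      by (rule det_identical_rows[OF jk]) (use jk in \<open>simp add: row_def\<close>)
    also have "(\<chi> i. if i = j then e j else ?c i) = (\<chi> i. ?c i)"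
      using jk insert.hyps by (auto simp: vec_eq_iff R_def)
    finally show ?case using insert by simp
  qed
  have "det (\<chi> i. R K i) = 1 + (\<Sum>i\<in>K. u $ i * v $ i)" if "finite K" for K
    using that
  proof (induction K rule: finite_induct)
    case empty
    have "(\<chi> i. R {} i) = mat 1"
      by (auto simp: vec_eq_iff R_def e_def mat_def axis_def)
    then show ?case by simp
  next
    case (insert j K)
    have "det (\<chi> i. R (insert j K) i) = det (\<chi> i. if i = j then e j + u $ j *s v else R K i)"
      using insert.hyps by (intro arg_cong[where f = det]) (auto simp: vec_eq_iff R_def)
    also have "\<dots> = det (\<chi> i. if i = j then e j else R K i) + det (\<chi> i. if i = j then u $ j *s v else R K i)"
      by (rule det_row_add)
    also have "det (\<chi> i. if i = j then u $ j *s v else R K i)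
      = u $ j * det (\<chi> i. if i = j then v else R K i)"
      by (rule det_row_mul)
    also have "\<dots> = u $ j * v $ j"
      by (subst aux[OF insert.hyps]) simp
    also have "(\<chi> i. if i = j then e j else R K i) = (\<chi> i. R K i)"
      using insert.hyps by (auto simp: vec_eq_iff R_def)
    finally show ?case using insert by simp
  qed
  moreover have "(\<chi> i. R UNIV i) = (\<chi> i j. (if i = j then 1 else 0) + u $ i * v $ j)"
    by (auto simp: R_def e_def axis_def vec_eq_iff)
  ultimately show ?thesis by (metis finite_class.finite_UNIV)
qed

section \<open>The projective map\<close>

text \<open>The projective transformation that fixes the origin and sends the hyperplane
  \<open>w \<bullet> t = 1\<close> to infinity. It is used on the side
  \<open>w \<bullet> t < 1\<close>, where it is injective and preserves convex hulls.\<close>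

definition proj_map :: "'a::real_inner \<Rightarrow> 'a \<Rightarrow> 'a" where
  "proj_map t w = (1 / (1 - w \<bullet> t)) *\<^sub>R w"

text \<open>The denominator at the image point is 1 + (w \<bullet> t)/(1 - w \<bullet> t) = 1/(1 - w
  \<bullet> t), so the second scaling undoes the first.\<close>

lemma proj_map_inverse:
  assumes "w \<bullet> t < 1"
  shows "proj_map (- t) (proj_map t w) = w" "proj_map t w \<bullet> (- t) < 1"
proof -
  have "1 + (w \<bullet> t) / (1 - w \<bullet> t) = 1 / (1 - w \<bullet> t)"
    using assms by (simp add: field_simps)
  moreover have "0 < 1 / (1 - w \<bullet> t)" using assms by simp
  moreover have "proj_map t w \<bullet> t = (w \<bullet> t) / (1 - w \<bullet> t)"
    by (simp add: proj_map_def)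
  ultimately show "proj_map (- t) (proj_map t w) = w" "proj_map t w \<bullet> (- t) < 1"
    using assms unfolding inner_minus_right by (simp add: proj_map_def, linarith)
qed

lemma inner_less_convex_hull:
  fixes t :: "'a::real_inner"
  assumes "\<And>x. x \<in> S \<Longrightarrow> x \<bullet> t < b" "w \<in> convex hull S"
  shows "w \<bullet> t < b"
proof -
  have "convex hull S \<subseteq> {x. t \<bullet> x < b}"
    using assms(1) by (intro hull_minimal convex_halfspace_lt) (auto simp: inner_commute)
  then show ?thesis using assms(2) by (auto simp: inner_commute)
qed

text \<open>A convex combination goes to a convex combination with rescaled weights: the weight a at
  x becomes a (1 - x \<bullet> t)/(1 - w \<bullet> t). The new weights sum to 1 because 1 - w
  \<bullet> t is affine in w.\<close>

lemma proj_map_convex_hull_subset: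
  assumes "\<And>x. x \<in> S \<Longrightarrow> x \<bullet> t < 1"
  shows "proj_map t ` (convex hull S) \<subseteq> convex hull (proj_map t ` S)"
proof -
  let ?A = "{w. w \<bullet> t < 1 \<and> proj_map t w \<in> convex hull (proj_map t ` S)}"
  have "convex ?A"
  proof (rule convexI)
    fix x y :: 'a and a b :: real
    assume xy: "x \<in> ?A" "y \<in> ?A" and ab: "0 \<le> a" "0 \<le> b" "a + b = 1"
    let ?w = "a *\<^sub>R x + b *\<^sub>R y"
    have w: "1 - ?w \<bullet> t = a * (1 - x \<bullet> t) + b * (1 - y \<bullet> t)"
      using ab(3) by (simp add: inner_add_left algebra_simps)
    have pos: "0 < 1 - ?w \<bullet> t"
      unfolding w using xy ab
      by (cases "a = 0") (auto intro!: add_pos_nonneg)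
    let ?\<alpha> = "a * (1 - x \<bullet> t) / (1 - ?w \<bullet> t)" and ?\<beta> = "b * (1 - y \<bullet> t) / (1 - ?w \<bullet> t)"
    have "?\<alpha> *\<^sub>R proj_map t x + ?\<beta> *\<^sub>R proj_map t y \<in> convex hull (proj_map t ` S)"
      using xy ab pos w
      by (intro convexD[OF convex_convex_hull]) (auto simp: add_divide_distrib[symmetric])
    also have "?\<alpha> *\<^sub>R proj_map t x + ?\<beta> *\<^sub>R proj_map t y = proj_map t ?w"
      using xy by (simp add: proj_map_def scaleR_add_right)
    finally show "?w \<in> ?A" using pos by simp
  qed
  moreover have "S \<subseteq> ?A" using assms by (auto intro: hull_inc)
  ultimately have "convex hull S \<subseteq> ?A" by (intro hull_minimal)
  then show ?thesis by auto
qed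

text \<open>The reverse inclusion is the forward one for \<open>- t\<close>, whose map is the
  inverse.\<close>

lemma proj_map_convex_hull:
  assumes "\<And>x. x \<in> S \<Longrightarrow> x \<bullet> t < 1"
  shows "proj_map t ` (convex hull S) = convex hull (proj_map t ` S)"
proof
  have neg: "z \<bullet> (- t) < 1" if "z \<in> proj_map t ` S" for z
    using that proj_map_inverse(2)[OF assms] by blast
  show "convex hull (proj_map t ` S) \<subseteq> proj_map t ` (convex hull S)"
  proof
    fix z assume z: "z \<in> convex hull (proj_map t ` S)"
    have "proj_map (- t) z \<in> convex hull (proj_map (- t) ` proj_map t ` S)"
      using proj_map_convex_hull_subset[OF neg] z by blast
    also have "proj_map (- t) ` proj_map t ` S = S"
      using proj_map_inverse(1)[OF assms] by force
    finally have "proj_map (- t) z \<in> convex hull S" .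
    moreover have "z \<bullet> (- t) < 1" using neg z by (rule inner_less_convex_hull)
    then have "z = proj_map t (proj_map (- t) z)"
      using proj_map_inverse(1)[of z "- t"] by simp
    ultimately show "z \<in> proj_map t ` (convex hull S)" by blast
  qed
qed (rule proj_map_convex_hull_subset[OF assms])

lemma proj_map_has_derivative:
  assumes "w \<bullet> t < 1"
  shows "(proj_map t has_derivative
    (\<lambda>h. (1 / (1 - w \<bullet> t)) *\<^sub>R h + ((h \<bullet> t) / (1 - w \<bullet> t)\<^sup>2) *\<^sub>R w)) (at w within S)"
proof -
  define r where "r = 1 - w \<bullet> t"
  have "((\<lambda>x. inverse (1 - x \<bullet> t)) has_derivative (\<lambda>h. (h \<bullet> t) * (inverse r * inverse r))) (at w within S)"
    using assms by (auto intro!: derivative_eq_intros simp: r_def mult_ac)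
  from has_derivative_scaleR[OF this has_derivative_ident]
  show ?thesis
    by (simp add: proj_map_def[abs_def] r_def divide_inverse power2_eq_square)
qed

text \<open>With r = 1 - w \<bullet> t the matrix is 1/r times the sum of the identity and the
  rank-one matrix (w/r) t^T. Scaling gives r^(-d), and the rank-one update 1 + (w \<bullet> t)/r =
  1/r supplies the last power.\<close>

lemma det_proj_map_derivative:
  fixes w t :: "real ^ 'n"
  assumes "w \<bullet> t < 1"
  shows "det (matrix (\<lambda>h. (1 / (1 - w \<bullet> t)) *\<^sub>R h + ((h \<bullet> t) / (1 - w \<bullet> t)\<^sup>2) *\<^sub>R w))
    = 1 / (1 - w \<bullet> t) ^ (CARD('n) + 1)"
proof -
  let ?r = "1 - w \<bullet> t" and ?u = "(1 / (1 - w \<bullet> t)) *\<^sub>R w"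
  have r: "?r \<noteq> 0" using assms by simp
  have "matrix (\<lambda>h. (1 / ?r) *\<^sub>R h + ((h \<bullet> t) / ?r\<^sup>2) *\<^sub>R w)
    = (\<chi> i. (1 / ?r) *s (\<chi> j. (if i = j then 1 else 0) + ?u $ i * t $ j))"
    using r by (simp add: vec_eq_iff matrix_def axis_def inner_axis' power2_eq_square
        cart_eq_inner_axis[symmetric] distrib_left) (simp add: inner_axis inner_commute axis_def[symmetric] field_simps)
  then have "det (matrix (\<lambda>h. (1 / ?r) *\<^sub>R h + ((h \<bullet> t) / ?r\<^sup>2) *\<^sub>R w))
    = (1 / ?r) ^ CARD('n) * (1 + (\<Sum>i\<in>UNIV. ?u $ i * t $ i))"
    by (simp only: det_rows_mul det_rank_one_update) simp
  also have "(\<Sum>i\<in>UNIV. ?u $ i * t $ i) = (w \<bullet> t) / ?r"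
    by (simp add: inner_vec_def sum_divide_distrib)
  also have "1 + (w \<bullet> t) / ?r = 1 / ?r" using r by (simp add: field_simps)
  finally show ?thesis by (simp add: power_divide)
qed

text \<open>Each edge of the image simplex is 1/(1 - v i \<bullet> t) times the old edge multiplied
  by I + t p^T/(1 - p \<bullet> t), a matrix common to all edges. The row scalings give the product
  over \<open>v\<close>, and the common matrix has determinant 1/(1 - p \<bullet> t), the factor of
  the base vertex.\<close>

lemma det_proj_map_simplex:
  fixes p t :: "real ^ 'n" and v :: "'n \<Rightarrow> real ^ 'n"
  assumes "p \<bullet> t < 1" "\<And>i. v i \<bullet> t < 1"
  shows "det (\<chi> i. proj_map t (v i) - proj_map t p)
    = det (\<chi> i. v i - p) / ((1 - p \<bullet> t) * (\<Prod>i\<in>UNIV. 1 - v i \<bullet> t))"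
proof -
  let ?r = "1 - p \<bullet> t"
  let ?M = "\<chi> i j. (if i = j then 1 else 0) + ((1 / ?r) *\<^sub>R t) $ i * p $ j"
  have r: "?r \<noteq> 0" "1 - v i \<bullet> t \<noteq> 0" for i using assms(1) assms(2)[of i] by auto
  have "proj_map t (v i) - proj_map t p
    = (1 / (1 - v i \<bullet> t)) *s ((\<chi> i. v i - p) ** ?M) $ i" for i
  proof -
    have "((\<chi> i. v i - p) ** ?M) $ i $ j = (v i - p) $ j + ((v i - p) \<bullet> t) / ?r * p $ j" for j
    proof -
      have "((\<chi> i. v i - p) ** ?M) $ i $ j
        = (\<Sum>k\<in>UNIV. (v i - p) $ k * (if k = j then 1 else 0)) + (\<Sum>k\<in>UNIV. (v i - p) $ k * t $ k) / ?r * p $ j"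
        unfolding matrix_matrix_mult_def
        by (simp add: distrib_left sum.distrib sum_divide_distrib sum_distrib_left sum_distrib_right mult_ac)
      then show ?thesis by (simp add: inner_vec_def if_distrib cong: if_cong)
    qed
    then show ?thesis
      using r by (simp add: vec_eq_iff proj_map_def inner_diff_left) (simp add: field_simps)
  qed
  then have "(\<chi> i. proj_map t (v i) - proj_map t p)
    = (\<chi> i. (1 / (1 - v i \<bullet> t)) *s ((\<chi> i. v i - p) ** ?M) $ i)"
    by simp
  then have "det (\<chi> i. proj_map t (v i) - proj_map t p)
    = (\<Prod>i\<in>UNIV. 1 / (1 - v i \<bullet> t)) * (det (\<chi> i. v i - p) * det ?M)"
    by (simp only: det_rows_mul vec_lambda_eta det_mul)
  also have "det ?M = 1 + (\<Sum>i\<in>UNIV. ((1 / ?r) *\<^sub>R t) $ i * p $ i)"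
    by (rule det_rank_one_update)
  also have "(\<Sum>i\<in>UNIV. ((1 / ?r) *\<^sub>R t) $ i * p $ i) = (p \<bullet> t) / ?r"
    by (simp add: inner_vec_def sum_divide_distrib mult_ac)
  also have "1 + (p \<bullet> t) / ?r = 1 / ?r" using r by (simp add: field_simps)
  finally show ?thesis by (simp add: prod_dividef mult_ac)
qed

lemma integral_proj_kernel_simplex_wellorder:
  fixes p t :: "real ^ 'n::{finite,wellorder}" and v :: "'n::_ \<Rightarrow> real ^ 'n::_"
  assumes "p \<bullet> t < 1" "\<And>i. v i \<bullet> t < 1"
  shows "(LINT w:convex hull (insert p (range v))|lborel. 1 / (1 - w \<bullet> t) ^ (CARD('n) + 1))
    = vol (convex hull (insert p (range v))) / ((1 - p \<bullet> t) * (\<Prod>i\<in>UNIV. 1 - v i \<bullet> t))"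
proof -
  define C where "C = convex hull (insert p (range v))"
  have lt: "w \<bullet> t < 1" if "w \<in> C" for w
    using that unfolding C_def by (rule inner_less_convex_hull[rotated]) (use assms in auto)
  have C: "compact C" unfolding C_def by (intro finite_imp_compact_convex_hull) simp
  have cont: "continuous_on C (\<lambda>w. 1 / (1 - w \<bullet> t) ^ (CARD('n) + 1))"
    using lt by (auto intro!: continuous_intros dest: lt)
  let ?D = "\<lambda>w h. (1 / (1 - w \<bullet> t)) *\<^sub>R h + ((h \<bullet> t) / (1 - w \<bullet> t)\<^sup>2) *\<^sub>R w"
  have det: "\<bar>det (matrix (?D w))\<bar> = 1 / (1 - w \<bullet> t) ^ (CARD('n) + 1)" if "w \<in> C" for w
    using lt[OF that] by (subst det_proj_map_derivative) auto
  have inj: "inj_on (proj_map t) C"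
    using proj_map_inverse(1)[OF lt] by (metis inj_onI)
  have im: "proj_map t ` C = convex hull (insert (proj_map t p) (range (\<lambda>i. proj_map t (v i))))"
    unfolding C_def using assms by (subst proj_map_convex_hull) (auto simp: image_image)
  have Cl: "C \<in> sets lebesgue" using C by (auto dest: compact_imp_closed)
  have "(LINT w:C|lborel. 1 / (1 - w \<bullet> t) ^ (CARD('n) + 1))
    = integral C (\<lambda>w. 1 / (1 - w \<bullet> t) ^ (CARD('n) + 1))"
    by (rule set_integral_eq_integral_compact[OF C cont])
  also have "\<dots> = integral C (\<lambda>w. \<bar>det (matrix (?D w))\<bar>)"
    by (intro integral_cong) (simp add: det)
  also have "\<dots> = measure lebesgue (proj_map t ` C)"
  proof (rule measure_differentiable_image_eq[symmetric, OF Cl _ inj])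
    show "(\<lambda>w. \<bar>det (matrix (?D w))\<bar>) integrable_on C"
      using set_borel_integral_eq_integral(1)[OF absolutely_integrable_continuous_compact(2)[OF C cont]]
      by (rule integrable_eq) (simp add: det)
  qed (intro proj_map_has_derivative lt)
  also have "\<dots> = vol (proj_map t ` C)"
    unfolding im
    by (intro measure_completion) (auto intro!: borel_compact finite_imp_compact_convex_hull)
  also have "\<dots> = vol C / ((1 - p \<bullet> t) * (\<Prod>i\<in>UNIV. 1 - v i \<bullet> t))"
  proof -
    have "0 < (1 - p \<bullet> t) * (\<Prod>i\<in>UNIV. 1 - v i \<bullet> t)"
      using assms by (intro mult_pos_pos prod_pos) auto
    \<comment> \<open>Both volumes carry the factor 1/d!, so their quotient is that of the two
      determinants.\<close>
    then show ?thesis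
      unfolding im unfolding C_def vol_simplex_wellorder det_proj_map_simplex[OF assms]
      by (simp add: abs_divide)
  qed
  finally show ?thesis unfolding C_def .
qed

section \<open>Transfer of the simplex formulas to arbitrary finite index types\<close>

lemma relabel_convex_hull:
  fixes f :: "'b::finite \<Rightarrow> 'a::finite"
  assumes "bij f"
  shows "{x :: real ^ 'a. (\<chi> i. x $ f i) \<in> convex hull S}
    = convex hull ((\<lambda>w. \<chi> i. w $ inv f i) ` S)"
proof -
  let ?R = "\<lambda>w :: real ^ 'b. \<chi> i. w $ inv f i"
  have "{x :: real ^ 'a. (\<chi> i. x $ f i) \<in> convex hull S} = ?R ` (convex hull S)"
  proof (intro set_eqI iffI)
    fix x :: "real ^ 'a" assume "x \<in> {x. (\<chi> i. x $ f i) \<in> convex hull S}"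
    moreover have "x = ?R (\<chi> i. x $ f i)"
      using assms by (simp add: vec_eq_iff bij_def surj_f_inv_f)
    ultimately show "x \<in> ?R ` (convex hull S)" by blast
  qed (use assms in \<open>auto simp: bij_def\<close>)
  also have "\<dots> = convex hull (?R ` S)"
    by (rule convex_hull_linear_image) (auto intro!: linearI simp: vec_eq_iff)
  finally show ?thesis .
qed

lemma range_reindex:
  assumes "bij f"
  shows "range (\<lambda>k. g (f k)) = range g"
proof -
  have "range (\<lambda>k. g (f k)) = g ` range f" by auto
  then show ?thesis using assms by (simp add: bij_def)
qed

lemma set_integral_simplex_relabel:
  fixes p :: "real ^ 'd" and v :: "'d \<Rightarrow> real ^ 'd" and \<iota> :: "'e::finite \<Rightarrow> 'd"
    and f :: "real ^ 'd \<Rightarrow> real"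
  assumes "bij \<iota>" "continuous_on (convex hull (insert p (range v))) f"
  shows "(LINT w:convex hull (insert p (range v))|lborel. f w) =
    (LINT x:convex hull (insert (\<chi> i. p $ \<iota> i) (range (\<lambda>k. \<chi> i. v (\<iota> k) $ \<iota> i)))|lborel.
      f (\<chi> i. x $ inv \<iota> i))"
proof -
  have r: "range (\<lambda>k. \<chi> i. v (\<iota> k) $ \<iota> i) = range (\<lambda>k. \<chi> i. v k $ \<iota> i)"
    using range_reindex[OF assms(1), of "\<lambda>k. \<chi> i. v k $ \<iota> i"] .
  show ?thesis
    using set_integral_relabel[OF bij_imp_bij_inv[OF assms(1)] _ assms(2)]
      relabel_convex_hull[OF bij_imp_bij_inv[OF assms(1)], of "insert p (range v)"]
    by (simp add: finite_imp_compact_convex_hull r image_image inv_inv_eq[OF assms(1)])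
qed

text \<open>\<open>\<iota>\<close> relabels the vertices as well as the coordinates, so that the
  edge matrix is square over the ordered index type.\<close>

lemma set_integral_simplex:
  fixes p :: "real ^ 'd" and v :: "'d \<Rightarrow> real ^ 'd" and \<iota> :: "'e::{finite,wellorder} \<Rightarrow> 'd"
  assumes "bij \<iota>" "continuous_on (convex hull (insert p (range v))) f"
  shows "(LINT w:convex hull (insert p (range v))|lborel. f w) =
    \<bar>det (\<chi> k i. (v (\<iota> k) - p) $ \<iota> i)\<bar> *
    (LINT x:std_simplex|lborel. f (p + (\<Sum>k\<in>UNIV. x $ k *\<^sub>R (v (\<iota> k) - p))))"
proof -
  let ?S = "insert (\<chi> i. p $ \<iota> i) (range (\<lambda>k. \<chi> i. v (\<iota> k) $ \<iota> i))"
  have "bij (inv \<iota>)" using assms(1) by (rule bij_imp_bij_inv)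
  have hull: "(\<chi> i. x $ inv \<iota> i) \<in> convex hull (insert p (range v))" if "x \<in> convex hull ?S" for x
  proof -
    have "range (\<lambda>k. \<chi> i. v (\<iota> k) $ \<iota> i) = range (\<lambda>k. \<chi> i. v k $ \<iota> i)"
      using range_reindex[OF assms(1), of "\<lambda>k. \<chi> i. v k $ \<iota> i"] .
    then show ?thesis
      using that relabel_convex_hull[OF \<open>bij (inv \<iota>)\<close>, of "insert p (range v)"]
      by (auto simp: image_image inv_inv_eq[OF assms(1)])
  qed
  have sur: "\<iota> (inv \<iota> i) = i" for i
    using assms(1) by (simp add: bij_def surj_f_inv_f)
  have arg: "(\<chi> i. ((\<chi> i. p $ \<iota> i) + (\<Sum>k\<in>UNIV. x $ k *\<^sub>R ((\<chi> i. v (\<iota> k) $ \<iota> i) - (\<chi> i. p $ \<iota> i)))) $ inv \<iota> i)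
    = p + (\<Sum>k\<in>UNIV. x $ k *\<^sub>R (v (\<iota> k) - p))" for x
    by (simp add: vec_eq_iff sur)
  have "continuous_on (convex hull ?S) (\<lambda>x. f (\<chi> i. x $ inv \<iota> i))"
    by (rule continuous_on_compose2[OF assms(2)]) (auto intro!: continuous_intros hull)
  from set_integral_simplex_wellorder[OF this] show ?thesis
    unfolding set_integral_simplex_relabel[OF assms] arg
    by (simp add: vec_eq_iff minus_vec_def)
qed

lemma integral_proj_kernel_simplex:
  fixes p t :: "real ^ 'd" and v :: "'d \<Rightarrow> real ^ 'd"
  assumes "p \<bullet> t < 1" "\<And>i. v i \<bullet> t < 1"
  shows "(LINT w:convex hull (insert p (range v))|lborel. 1 / (1 - w \<bullet> t) ^ (CARD('d) + 1))
    = vol (convex hull (insert p (range v))) / ((1 - p \<bullet> t) * (\<Prod>i\<in>UNIV. 1 - v i \<bullet> t))"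
proof -
  obtain \<iota> :: "'d wo \<Rightarrow> 'd" where \<iota>: "bij \<iota>" using ex_bij_wo by blast
  let ?R = "\<lambda>w :: real ^ 'd. (\<chi> i. w $ \<iota> i) :: real ^ 'd wo"
  \<comment> \<open>Relabelling preserves inner products, hence the kernel and all the linear
    factors.\<close>
  have inner: "?R a \<bullet> ?R b = a \<bullet> b" for a b
    unfolding inner_vec_def using sum.reindex_bij_betw[OF \<iota>, of "\<lambda>i. a $ i * b $ i"] by simp
  have sur: "\<iota> (inv \<iota> i) = i" "inv \<iota> (\<iota> j) = j" for i j
    using \<iota> by (simp_all add: bij_def surj_f_inv_f)
  have inner': "(\<chi> i. x $ inv \<iota> i) \<bullet> t = x \<bullet> ?R t" for x :: "real ^ 'd wo"
    using inner[of "\<chi> i. x $ inv \<iota> i" t] by (simp add: sur)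
  have lt: "w \<bullet> t < 1" if "w \<in> convex hull (insert p (range v))" for w
    using that by (rule inner_less_convex_hull[rotated]) (use assms in auto)
  have "continuous_on (convex hull (insert p (range v))) (\<lambda>w. 1 / (1 - w \<bullet> t) ^ (CARD('d) + 1))"
    using lt by (auto intro!: continuous_intros dest: lt)
  from set_integral_simplex_relabel[OF \<iota> this]
  have 1: "(LINT w:convex hull (insert p (range v))|lborel. 1 / (1 - w \<bullet> t) ^ (CARD('d) + 1))
    = vol (convex hull (insert (?R p) (range (\<lambda>k. ?R (v (\<iota> k)))))) /
      ((1 - p \<bullet> t) * (\<Prod>i\<in>UNIV. 1 - v (\<iota> i) \<bullet> t))"
    using integral_proj_kernel_simplex_wellorder[of "?R p" "?R t" "\<lambda>k. ?R (v (\<iota> k))"] assms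
    by (simp add: inner inner')
  have 2: "vol (convex hull (insert p (range v)))
    = vol (convex hull (insert (?R p) (range (\<lambda>k. ?R (v (\<iota> k))))))"
    using set_integral_simplex_relabel[OF \<iota>, of p v "\<lambda>_. 1"]
    by (simp add: set_lebesgue_integral_def)
  show ?thesis
    unfolding 1 2 using prod.reindex_bij_betw[OF \<iota>, of "\<lambda>i. 1 - v i \<bullet> t"] by simp
qed

section \<open>Integrals over triangulations\<close>

lemma set_integral_UN_negligible:
  fixes f :: "'a::euclidean_space \<Rightarrow> real"
  assumes "finite I" "\<And>i. i \<in> I \<Longrightarrow> compact (T i)"
    and "pairwise (\<lambda>i j. negligible (T i \<inter> T j)) I"
    and "continuous_on (\<Union>i\<in>I. T i) f"
  shows "(LINT w:(\<Union>i\<in>I. T i)|lborel. f w) = (\<Sum>i\<in>I. LINT w:T i|lborel. f w)"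
proof -
  have c: "continuous_on (T i) f" if "i \<in> I" for i
    using that by (intro continuous_on_subset[OF assms(4)]) auto
  have int: "(f has_integral (LINT w:T i|lborel. f w)) (T i)" if "i \<in> I" for i
    using set_borel_integral_eq_integral[OF absolutely_integrable_continuous_compact(2)[OF assms(2)[OF that] c[OF that]]]
    by (metis integrable_integral)
  have "compact (\<Union>i\<in>I. T i)" using assms(1,2) by (intro compact_UN) auto
  then have "(LINT w:(\<Union>i\<in>I. T i)|lborel. f w) = integral (\<Union>i\<in>I. T i) f"
    using assms(4) by (rule set_integral_eq_integral_compact)
  also have "\<dots> = (\<Sum>i\<in>I. LINT w:T i|lborel. f w)"
    using has_integral_UN[OF assms(1) int assms(3)] by (rule integral_unique)
  finally show ?thesis .
qed

section \<open>Overlaps in a triangulation as null sets\<close>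

lemma negligible_convex_lowdim:
  fixes S :: "'a::euclidean_space set"
  assumes "convex S" "aff_dim S < int DIM('a)"
  shows "negligible S"
  using assms low_dim_interior[of S] by (auto simp: negligible_convex_interior)

lemma vol_pos_of_aff_dim:
  fixes S :: "(real ^ 'd) set"
  assumes "compact S" "convex S" "aff_dim S = int CARD('d)"
  shows "vol S > 0"
proof -
  have "rel_interior S \<noteq> {}"
    using assms by (metis aff_dim_empty rel_interior_eq_empty of_nat_0_le_iff not_one_le_zero neg_0_le_iff_le)
  then have "interior S \<noteq> {}" using interior_rel_interior_gen[of S] assms(3) by simp
  then have "\<not> negligible S" using assms(2) by (simp add: negligible_convex_interior)
  moreover have "S \<in> lmeasurable" using assms(1) by (rule lmeasurable_compact)
  moreover have "measure lebesgue S = vol S"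
    using assms(1) by (intro measure_completion) (auto intro: borel_compact)
  ultimately show ?thesis
    using negligible_iff_measure0 by (metis measure_nonneg less_eq_real_def)
qed

lemma compact_conv_rows: "compact (conv_rows X \<sigma>)" for X :: "real ^ 'd ^ 'n"
  unfolding conv_rows_def by (intro finite_imp_compact_convex_hull) simp

text \<open>The d + 1 vertices of the simplex all occur among the at most d + 1 points labelled by
  \<open>\<sigma>\<close>, so counting gives equality. When the rows are distinct, the label set can
  therefore be recovered from its hull.\<close>

lemma extreme_points_conv_rows_simplex:
  fixes X :: "real ^ 'd ^ 'n"
  assumes "card \<sigma> = CARD('d) + 1" "int CARD('d) simplex conv_rows X \<sigma>"
  shows "{x. x extreme_point_of conv_rows X \<sigma>} = (\<lambda>k. X $ k) ` \<sigma>"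
proof -
  obtain C where C: "\<not> affine_dependent C" "int (card C) = int CARD('d) + 1" "conv_rows X \<sigma> = convex hull C"
    using assms(2) by (auto simp: simplex_def)
  have ext: "{x. x extreme_point_of conv_rows X \<sigma>} = C"
    unfolding C(3) using extreme_point_of_convex_hull_affine_independent[OF C(1)] by blast
  have "C \<subseteq> (\<lambda>k. X $ k) ` \<sigma>"
    unfolding ext[symmetric] conv_rows_def using extreme_point_of_convex_hull by blast
  moreover have "card ((\<lambda>k. X $ k) ` \<sigma>) \<le> card C"
    using C(2) assms(1) card_image_le[of \<sigma> "\<lambda>k. X $ k"] by simp
  ultimately show ?thesis
    unfolding ext by (intro card_seteq) auto
qed

lemma set_integral_triangulates:
  fixes X :: "real ^ 'd ^ 'n" and f :: "real ^ 'd \<Rightarrow> real"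
  assumes "triangulates X \<Sigma> P" "inj (\<lambda>k. X $ k)" "continuous_on P f"
  shows "(LINT w:P|lborel. f w) = (\<Sum>\<sigma>\<in>\<Sigma>. LINT w:conv_rows X \<sigma>|lborel. f w)"
proof -
  have P: "P = (\<Union>\<sigma>\<in>\<Sigma>. conv_rows X \<sigma>)"
    and tri: "triangulation (conv_rows X ` \<Sigma>)"
    and card: "\<And>\<sigma>. \<sigma> \<in> \<Sigma> \<Longrightarrow> card \<sigma> = CARD('d) + 1"
    and simplex: "\<And>\<sigma>. \<sigma> \<in> \<Sigma> \<Longrightarrow> int CARD('d) simplex conv_rows X \<sigma>"
    using assms(1) by (simp_all add: triangulates_def)
  have "negligible (conv_rows X \<sigma> \<inter> conv_rows X \<tau>)" if "\<sigma> \<in> \<Sigma>" "\<tau> \<in> \<Sigma>" "\<sigma> \<noteq> \<tau>" for \<sigma> \<tau>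
  proof -
    let ?S = "conv_rows X \<sigma>" and ?T = "conv_rows X \<tau>"
    \<comment> \<open>Distinct label sets must span distinct simplices, for otherwise the sum over
      \<open>\<Sigma>\<close> would count one simplex twice.\<close>
    have "(\<lambda>k. X $ k) ` \<sigma> \<noteq> (\<lambda>k. X $ k) ` \<tau>"
      using that(3) assms(2) by (simp add: inj_image_eq_iff)
    then have ne: "?S \<noteq> ?T"
      using extreme_points_conv_rows_simplex[OF card simplex] that(1,2) by metis
    have faces: "(A \<inter> B) face_of A" if "A \<in> conv_rows X ` \<Sigma>" "B \<in> conv_rows X ` \<Sigma>" for A B
      using tri that by (simp add: triangulation_def)
    have f: "(?S \<inter> ?T) face_of ?S" "(?S \<inter> ?T) face_of ?T"
      using faces[of ?S ?T] faces[of ?T ?S] that(1,2) by (simp_all add: Int_commute)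
    have conv: "convex ?S" "convex ?T" by (simp_all add: conv_rows_def)
    have dim: "aff_dim ?S = int CARD('d)" "aff_dim ?T = int CARD('d)"
      using aff_dim_simplex simplex that(1,2) by blast+
    \<comment> \<open>The common face is proper in at least one of the two simplices.\<close>
    have "aff_dim (?S \<inter> ?T) < int CARD('d)"
    proof (cases "?S \<inter> ?T = ?S")
      case True
      then have "?S \<inter> ?T \<noteq> ?T" using ne by simp
      then show ?thesis using face_of_aff_dim_lt[OF conv(2) f(2)] dim by simp
    next
      case False
      then show ?thesis using face_of_aff_dim_lt[OF conv(1) f(1)] dim by simp
    qed
    then show ?thesis
      using conv by (intro negligible_convex_lowdim convex_Int) auto
  qed
  then have "pairwise (\<lambda>\<sigma> \<tau>. negligible (conv_rows X \<sigma> \<inter> conv_rows X \<tau>)) \<Sigma>"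
    by (simp add: pairwise_def)
  then show ?thesis
    using assms(3) unfolding P by (intro set_integral_UN_negligible) (auto intro: compact_conv_rows)
qed

text \<open>Singles out a base vertex and enumerates the others by the coordinate type, the form in
  which the simplex formulas are stated.\<close>

lemma conv_rows_eq_simplex:
  fixes X :: "real ^ 'd ^ 'n"
  assumes "card \<sigma> = CARD('d) + 1"
  obtains k e where "k \<in> \<sigma>" "bij_betw e (UNIV :: 'd set) (\<sigma> - {k})"
    "conv_rows X \<sigma> = convex hull (insert (X $ k) (range (\<lambda>i. X $ e i)))"
proof -
  obtain k where k: "k \<in> \<sigma>" using assms by fastforce
  then have "card (\<sigma> - {k}) = CARD('d)" using assms by simp
  then obtain e where e: "bij_betw e (UNIV :: 'd set) (\<sigma> - {k})"
    using finite_same_card_bij[of "UNIV :: 'd set" "\<sigma> - {k}"] by auto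
  have "(\<lambda>k. X $ k) ` \<sigma> = insert (X $ k) (range (\<lambda>i. X $ e i))"
    using k e unfolding bij_betw_def by (metis image_image image_insert insert_Diff)
  with k e show ?thesis using that unfolding conv_rows_def by metis
qed

lemma integral_proj_kernel_triangulates:
  fixes X :: "real ^ 'd ^ 'n"
  assumes "triangulates X \<Sigma> P" "inj (\<lambda>k. X $ k)" "vol P \<noteq> 0" "\<And>k. X $ k \<bullet> t < 1"
  shows "(LINT w:P|lborel. 1 / (1 - w \<bullet> t) ^ (CARD('d) + 1)) = vol P * triangulation_sum X \<Sigma> P t"
proof -
  have P: "P = (\<Union>\<sigma>\<in>\<Sigma>. conv_rows X \<sigma>)"
    and card: "\<And>\<sigma>. \<sigma> \<in> \<Sigma> \<Longrightarrow> card \<sigma> = CARD('d) + 1"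
    using assms(1) by (simp_all add: triangulates_def)
  have lt: "w \<bullet> t < 1" if w: "w \<in> P" for w
  proof -
    obtain \<sigma> where "\<sigma> \<in> \<Sigma>" "w \<in> convex hull ((\<lambda>k. X $ k) ` \<sigma>)"
      using w unfolding P conv_rows_def by blast
    note this(2)
    then show ?thesis by (rule inner_less_convex_hull[rotated]) (use assms(4) in auto)
  qed
  have "continuous_on P (\<lambda>w. 1 / (1 - w \<bullet> t) ^ (CARD('d) + 1))"
    using lt by (auto intro!: continuous_intros dest: lt)
  then have "(LINT w:P|lborel. 1 / (1 - w \<bullet> t) ^ (CARD('d) + 1))
    = (\<Sum>\<sigma>\<in>\<Sigma>. LINT w:conv_rows X \<sigma>|lborel. 1 / (1 - w \<bullet> t) ^ (CARD('d) + 1))"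
    by (rule set_integral_triangulates[OF assms(1,2)])
  also have "\<dots> = (\<Sum>\<sigma>\<in>\<Sigma>. vol (conv_rows X \<sigma>) / (\<Prod>k\<in>\<sigma>. 1 - X $ k \<bullet> t))"
  proof (rule sum.cong[OF refl])
    fix \<sigma> assume "\<sigma> \<in> \<Sigma>"
    then obtain k e where k: "k \<in> \<sigma>" and e: "bij_betw e (UNIV :: 'd set) (\<sigma> - {k})"
      and hull: "conv_rows X \<sigma> = convex hull (insert (X $ k) (range (\<lambda>i. X $ e i)))"
      using conv_rows_eq_simplex[OF card] by metis
    have "(\<Prod>k\<in>\<sigma>. 1 - X $ k \<bullet> t) = (1 - X $ k \<bullet> t) * (\<Prod>i\<in>UNIV. 1 - X $ e i \<bullet> t)"
      using prod.remove[OF _ k, of "\<lambda>k. 1 - X $ k \<bullet> t"]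
        prod.reindex_bij_betw[OF e, of "\<lambda>k. 1 - X $ k \<bullet> t"] by simp
    then show "(LINT w:conv_rows X \<sigma>|lborel. 1 / (1 - w \<bullet> t) ^ (CARD('d) + 1))
      = vol (conv_rows X \<sigma>) / (\<Prod>k\<in>\<sigma>. 1 - X $ k \<bullet> t)"
      unfolding hull by (simp only: integral_proj_kernel_simplex assms(4))
  qed
  also have "\<dots> = vol P * triangulation_sum X \<Sigma> P t"
    using assms(3) by (simp add: triangulation_sum_def inner_vec_def)
  finally show ?thesis .
qed

section \<open>The moment generating series\<close>

lemma finite_degree_eq: "finite {I :: 'd::finite \<Rightarrow> nat. (\<Sum>l\<in>UNIV. I l) = m}"
proof (rule finite_subset)
  show "{I :: 'd \<Rightarrow> nat. (\<Sum>l\<in>UNIV. I l) = m} \<subseteq> Pi\<^sub>E UNIV (\<lambda>_. {..m})"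
  proof
    fix I :: "'d \<Rightarrow> nat" assume "I \<in> {I. (\<Sum>l\<in>UNIV. I l) = m}"
    moreover have "I l \<le> (\<Sum>l\<in>UNIV. I l)" for l by (rule member_le_sum) auto
    ultimately show "I \<in> Pi\<^sub>E UNIV (\<lambda>_. {..m})" by (simp add: PiE_UNIV_domain)
  qed
qed (intro finite_PiE; simp)

text \<open>Let S_m be the left-hand sum. The induction rests on (m + 1) S_(m+1) = (sum of the z l)
  S_m: write m + 1 as the sum of the entries of \<open>I\<close>, then lower entry \<open>l\<close>
  by one, which trades the factor \<open>I l\<close> for \<open>z l\<close>.\<close>

lemma multinomial_formula:
  fixes z :: "'d::finite \<Rightarrow> real"
  shows "(\<Sum>I | (\<Sum>l\<in>UNIV. I l) = m. \<Prod>l\<in>UNIV. z l ^ I l / fact (I l)) = (\<Sum>l\<in>UNIV. z l) ^ m / fact m"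
proof (induction m)
  case 0
  have "{I :: 'd \<Rightarrow> nat. (\<Sum>l\<in>UNIV. I l) = 0} = {\<lambda>_. 0}" by auto
  then show ?case by simp
next
  case (Suc m)
  define D where "D = (\<lambda>m. {I :: 'd \<Rightarrow> nat. (\<Sum>l\<in>UNIV. I l) = m})"
  define q where "q = (\<lambda>I. \<Prod>l\<in>UNIV. z l ^ I l / fact (I l))"
  have fin: "finite (D m)" for m unfolding D_def by (rule finite_degree_eq)
  have step: "(\<Sum>I\<in>D (Suc m). real (I l) * q I) = z l * (\<Sum>J\<in>D m. q J)" for l
  proof -
    have upd: "(\<Sum>k\<in>UNIV. (J(l := n)) k) = n + (\<Sum>k\<in>UNIV - {l}. J k)" for J :: "'d \<Rightarrow> nat" and n
      by (subst sum.remove[of _ l]) auto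
    have spl: "(\<Sum>k\<in>UNIV. J k) = J l + (\<Sum>k\<in>UNIV - {l}. J k)" for J :: "'d \<Rightarrow> nat"
      by (rule sum.remove) auto
    have "z l * (\<Sum>J\<in>D m. q J) = (\<Sum>J\<in>D m. z l * q J)" by (rule sum_distrib_left)
    also have "\<dots> = (\<Sum>I\<in>D (Suc m). real (I l) * q I)"
    \<comment> \<open>Raising entry \<open>l\<close> misses exactly the exponents with
      \<open>I l = 0\<close>, whose terms vanish through the factor \<open>I l\<close>.\<close>
    proof (rule sum.reindex_bij_witness_not_neutral[where
          S' = "{}" and T' = "{I \<in> D (Suc m). I l = 0}" and i = "\<lambda>I. I(l := I l - 1)" and j = "\<lambda>J. J(l := J l + 1)"])
      fix J assume "J \<in> D m"
      have "q (J(l := J l + 1)) = z l ^ (J l + 1) / fact (J l + 1) * (\<Prod>k\<in>UNIV - {l}. z k ^ J k / fact (J k))"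
        unfolding q_def by (subst prod.remove[of _ l]) (auto intro!: prod.cong)
      moreover have "q J = z l ^ J l / fact (J l) * (\<Prod>k\<in>UNIV - {l}. z k ^ J k / fact (J k))"
        unfolding q_def by (subst prod.remove[of _ l]) auto
      moreover have n: "real (J l + 1) * (z l ^ (J l + 1) / fact (J l + 1)) = z l * (z l ^ J l / fact (J l))"
        by (simp add: fact_Suc del: of_nat_Suc)
      ultimately show "real ((J(l := J l + 1)) l) * q (J(l := J l + 1)) = z l * q J"
        using n by (simp only: mult.assoc[symmetric] fun_upd_same)
    next
      fix J assume "J \<in> D m - {}"
      then show "J(l := J l + 1) \<in> D (Suc m) - {I \<in> D (Suc m). I l = 0}"
        unfolding D_def using upd[of J "J l + 1"] spl[of J] by simp
    next
      fix I assume "I \<in> D (Suc m) - {I \<in> D (Suc m). I l = 0}"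
      then show "I(l := I l - 1) \<in> D m - {}"
        unfolding D_def using upd[of I "I l - 1"] spl[of I] by (simp, linarith)
    qed (use fin in auto)
    finally show ?thesis ..
  qed
  have "real (Suc m) * (\<Sum>I\<in>D (Suc m). q I) = (\<Sum>I\<in>D (Suc m). (\<Sum>l\<in>UNIV. real (I l)) * q I)"
    unfolding sum_distrib_left D_def
    by (intro sum.cong) (simp_all flip: of_nat_sum)
  also have "\<dots> = (\<Sum>l\<in>UNIV. \<Sum>I\<in>D (Suc m). real (I l) * q I)"
    unfolding sum_distrib_right by (rule sum.swap)
  also have "\<dots> = (\<Sum>l\<in>UNIV. z l) * ((\<Sum>l\<in>UNIV. z l) ^ m / fact m)"
    unfolding step sum_distrib_right[symmetric] using Suc.IH by (simp add: D_def q_def)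
  finally have "(\<Sum>I\<in>D (Suc m). q I) = (\<Sum>l\<in>UNIV. z l) * ((\<Sum>l\<in>UNIV. z l) ^ m / fact m) / real (Suc m)"
    by (metis nonzero_mult_div_cancel_left of_nat_0_eq_iff nat.distinct(1))
  then show ?case
    by (simp add: D_def q_def fact_Suc mult.commute del: of_nat_Suc)
qed

text \<open>Newton's series for the exponent -(d + 1). Upper negation turns its coefficients into
  ordinary binomial coefficients, with a sign that cancels against the one in
  \<open>- z\<close>.\<close>

lemma negative_binomial_sums:
  fixes z :: real
  assumes "\<bar>z\<bar> < 1"
  shows "(\<lambda>m. real ((m + d) choose d) * z ^ m) sums (1 / (1 - z) ^ (d + 1))"
proof -
  have "(\<lambda>m. ((- real (d + 1)) gchoose m) * (- z) ^ m) sums (1 + (- z)) powr (- real (d + 1))"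
    using assms by (intro gen_binomial_real) simp
  also have "(\<lambda>m. ((- real (d + 1)) gchoose m) * (- z) ^ m) = (\<lambda>m. real ((m + d) choose d) * z ^ m)"
  proof
    fix m
    have "(- real (d + 1)) gchoose m = (- 1) ^ m * (real (m + d) gchoose m)"
      by (subst gbinomial_minus) (simp add: add_ac)
    also have "real (m + d) gchoose m = real ((m + d) choose m)"
      by (simp add: binomial_gbinomial)
    also have "(m + d) choose m = (m + d) choose d"
      by (subst binomial_symmetric) simp_all
    finally have "((- real (d + 1)) gchoose m) * (- z) ^ m
      = ((- 1) ^ m * (- 1) ^ m) * (real ((m + d) choose d) * z ^ m)"
      by (simp only: power_minus[of z] mult_ac)
    also have "(- 1) ^ m * (- 1) ^ m = (1::real)"
      by (simp flip: power_mult_distrib)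
    finally show "((- real (d + 1)) gchoose m) * (- z) ^ m = real ((m + d) choose d) * z ^ m"
      by simp
  qed
  also have "(1 + (- z)) powr (- real (d + 1)) = 1 / (1 - z) ^ (d + 1)"
    using assms by (subst powr_minus_divide, subst powr_realpow) auto
  finally show ?thesis .
qed

lemma integral_uniform_measure:
  fixes f :: "real ^ 'd \<Rightarrow> real"
  assumes "compact P" "continuous_on UNIV f"
  shows "(\<integral>w. f w \<partial>uniform_measure lborel P) = (LINT w:P|lborel. f w) / vol P"
proof -
  have P[measurable]: "P \<in> sets borel" using assms(1) by (rule borel_compact)
  have f[measurable]: "f \<in> borel_measurable borel"
    using assms(2) by (rule borel_measurable_continuous_onI)
  have fin: "emeasure lborel P < \<infinity>"
    using assms(1) by (intro emeasure_bounded_finite compact_imp_bounded)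
  show ?thesis
  proof (cases "vol P = 0")
    \<comment> \<open>Over a null set the density vanishes almost everywhere, and division by zero
      makes the right-hand side 0 as well.\<close>
    case True
    then have "emeasure lborel P = 0" using fin by (simp add: emeasure_eq_ennreal_measure)
    then have "AE w in lborel. w \<notin> P"
      by (intro AE_not_in) (auto simp: null_sets_def)
    then have "AE w in lborel. indicator P w / emeasure lborel P = (0::ennreal)"
      by eventually_elim simp
    then have "uniform_measure lborel P = density lborel (\<lambda>_. 0)"
      unfolding uniform_measure_def by (intro density_cong) auto
    then have "(\<integral>w. f w \<partial>uniform_measure lborel P) = 0"
      using integral_density[of f lborel "\<lambda>_. 0"] by simp
    then show ?thesis using True by simp
  next
    case False
    then have pos: "vol P > 0" by (simp add: zero_less_measure_iff)
    have "uniform_measure lborel P = density lborel (\<lambda>w. ennreal (indicator P w / vol P))"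
      unfolding uniform_measure_def
    proof (rule arg_cong[where f = "density lborel"], rule ext)
      fix w
      have "emeasure lborel P = ennreal (vol P)" using fin by (simp add: emeasure_eq_ennreal_measure)
      then show "indicator P w / emeasure lborel P = ennreal (indicator P w / vol P)"
        using pos by (auto simp: indicator_def divide_ennreal simp flip: ennreal_1)
    qed
    then have "(\<integral>w. f w \<partial>uniform_measure lborel P) = (\<integral>w. (indicator P w / vol P) *\<^sub>R f w \<partial>lborel)"
      by (simp add: integral_density)
    also have "\<dots> = (\<integral>w. (indicator P w *\<^sub>R f w) / vol P \<partial>lborel)" by simp
    also have "\<dots> = (LINT w:P|lborel. f w) / vol P"
      unfolding set_lebesgue_integral_def by (rule integral_divide_zero)
    finally show ?thesis .
  qed
qed

lemma moment_eq:
  assumes "compact P"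
  shows "moment P I = (LINT w:P|lborel. \<Prod>l\<in>UNIV. (w $ l) ^ I l) / vol P"
  unfolding moment_def by (rule integral_uniform_measure[OF assms]) (intro continuous_intros)

lemma set_integral_mono_compact:
  fixes f g :: "'a::euclidean_space \<Rightarrow> real"
  assumes "compact S" "continuous_on S f" "continuous_on S g" "\<And>x. x \<in> S \<Longrightarrow> f x \<le> g x"
  shows "(LINT w:S|lborel. f w) \<le> (LINT w:S|lborel. g w)"
  by (intro set_integral_mono absolutely_integrable_continuous_compact(2) assms)

lemma abs_moment_le:
  fixes P :: "(real ^ 'd) set"
  assumes "compact P" "\<And>w l. w \<in> P \<Longrightarrow> \<bar>w $ l\<bar> \<le> R" "vol P > 0"
  shows "\<bar>moment P I\<bar> \<le> (\<Prod>l\<in>UNIV. R ^ I l)"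
proof -
  let ?f = "\<lambda>w :: real ^ 'd. \<Prod>l\<in>UNIV. (w $ l) ^ I l"
  have cont: "continuous_on P ?f" by (intro continuous_intros)
  have le: "\<bar>?f w\<bar> \<le> (\<Prod>l\<in>UNIV. R ^ I l)" if "w \<in> P" for w
    unfolding abs_prod by (intro prod_mono) (auto simp: power_abs intro!: power_mono assms(2) that)
  have c: "(LINT w:P|lborel. c) = c * vol P" for c :: real
    by (simp add: set_lebesgue_integral_def mult.commute)
  have "(LINT w:P|lborel. ?f w) \<le> (LINT w:P|lborel. \<Prod>l\<in>UNIV. R ^ I l)"
    using le by (intro set_integral_mono_compact assms(1) cont) (auto simp: abs_le_iff)
  moreover have "(LINT w:P|lborel. - (\<Prod>l\<in>UNIV. R ^ I l)) \<le> (LINT w:P|lborel. ?f w)"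
    using le by (intro set_integral_mono_compact assms(1) cont) (force simp: abs_le_iff)+
  ultimately have "\<bar>LINT w:P|lborel. ?f w\<bar> \<le> (\<Prod>l\<in>UNIV. R ^ I l) * vol P"
    unfolding c by (simp add: abs_le_iff)
  then show ?thesis
    unfolding moment_eq[OF assms(1)] using assms(3) by (simp add: field_simps)
qed

lemma set_integral_sum_compact:
  fixes f :: "'i \<Rightarrow> 'a::euclidean_space \<Rightarrow> real"
  assumes "compact S" "\<And>i. i \<in> A \<Longrightarrow> continuous_on S (f i)"
  shows "(LINT x:S|lborel. \<Sum>i\<in>A. f i x) = (\<Sum>i\<in>A. LINT x:S|lborel. f i x)"
  unfolding set_lebesgue_integral_def scaleR_sum_right
  by (intro Bochner_Integration.integral_sum borel_integrable_compact assms)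

text \<open>Within one total degree the multinomial theorem assembles the monomials into (w
  \<bullet> t)^m/m!. The remaining factor (m + d)!/d! completes the coefficient of z^m in (1 -
  z)^(-(d+1)).\<close>

lemma sum_normalized_mgf_term_degree:
  fixes P :: "(real ^ 'd) set"
  assumes "compact P"
  shows "(\<Sum>I | (\<Sum>l\<in>UNIV. I l) = m. normalized_mgf_term P t I)
    = (LINT w:P|lborel. real ((m + CARD('d)) choose CARD('d)) * (w \<bullet> t) ^ m) / vol P"
proof -
  let ?c = "fact (m + CARD('d)) / fact CARD('d) :: real"
  have "(\<Sum>I | (\<Sum>l\<in>UNIV. I l) = m. normalized_mgf_term P t I)
    = (\<Sum>I | (\<Sum>l\<in>UNIV. I l) = m. (LINT w:P|lborel. ?c * (\<Prod>l\<in>UNIV. (w $ l * t $ l) ^ I l / fact (I l))) / vol P)"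
  proof (rule sum.cong[OF refl])
    fix I :: "'d \<Rightarrow> nat" assume "I \<in> {I. (\<Sum>l\<in>UNIV. I l) = m}"
    then have m: "(\<Sum>l\<in>UNIV. I l) = m" by simp
    let ?a = "?c * (\<Prod>l\<in>UNIV. t $ l ^ I l) / (\<Prod>l\<in>UNIV. fact (I l))"
    have "?c * (\<Prod>l\<in>UNIV. (w $ l * t $ l) ^ I l / fact (I l)) = ?a * (\<Prod>l\<in>UNIV. w $ l ^ I l)" for w :: "real ^ 'd"
      by (simp add: prod_dividef power_mult_distrib prod.distrib)
    then show "normalized_mgf_term P t I
      = (LINT w:P|lborel. ?c * (\<Prod>l\<in>UNIV. (w $ l * t $ l) ^ I l / fact (I l))) / vol P"
      unfolding normalized_mgf_term_def moment_eq[OF assms] m by (simp add: mult_ac)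
  qed
  also have "\<dots> = (LINT w:P|lborel. \<Sum>I | (\<Sum>l\<in>UNIV. I l) = m.
      ?c * (\<Prod>l\<in>UNIV. (w $ l * t $ l) ^ I l / fact (I l))) / vol P"
    unfolding sum_divide_distrib[symmetric]
    by (subst set_integral_sum_compact) (auto intro!: assms continuous_intros)
  also have "(\<lambda>w. \<Sum>I | (\<Sum>l\<in>UNIV. I l) = m. ?c * (\<Prod>l\<in>UNIV. (w $ l * t $ l) ^ I l / fact (I l)))
    = (\<lambda>w. real ((m + CARD('d)) choose CARD('d)) * (w \<bullet> t) ^ m)"
    unfolding sum_distrib_left[symmetric] multinomial_formula
    by (simp add: inner_vec_def binomial_fact)
  finally show ?thesis .
qed

text \<open>An unordered sum over exponents calls for absolute convergence: in degree m the absolute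
  values add up to at most \<open>b m\<close>, the term of a convergent series. After that the value
  can be computed degree by degree.\<close>

lemma has_sum_normalized_mgf_term:
  fixes P :: "(real ^ 'd) set"
  assumes P: "compact P" "vol P > 0" and R: "R \<ge> 0" "\<And>w l. w \<in> P \<Longrightarrow> \<bar>w $ l\<bar> \<le> R"
    and t: "R * (\<Sum>l\<in>UNIV. \<bar>t $ l\<bar>) < 1"
  shows "(normalized_mgf_term P t has_sum
    (LINT w:P|lborel. 1 / (1 - w \<bullet> t) ^ (CARD('d) + 1)) / vol P) UNIV"
proof -
  let ?T = "normalized_mgf_term P t"
  define D where "D = (\<lambda>m. {I :: 'd \<Rightarrow> nat. (\<Sum>l\<in>UNIV. I l) = m})"
  \<comment> \<open>A bound for |w \<bullet> t| on \<open>P\<close>. Being below 1, it gives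
    convergence both of the absolute values and of the expansion of the kernel.\<close>
  define q where "q = R * (\<Sum>l\<in>UNIV. \<bar>t $ l\<bar>)"
  define b where "b = (\<lambda>m. real ((m + CARD('d)) choose CARD('d)) * q ^ m)"
  define E where "E = (\<lambda>M. \<Union>m<M. D m)"
  have q: "0 \<le> q" "q < 1"
    using t R(1) by (auto simp: q_def intro!: mult_nonneg_nonneg sum_nonneg)
  have b0: "0 \<le> b m" for m using q by (simp add: b_def)
  have b: "summable b"
    using negative_binomial_sums[of q "CARD('d)"] q by (auto simp: b_def sums_iff)
  have inner: "\<bar>w \<bullet> t\<bar> \<le> q" if "w \<in> P" for w
  proof -
    have "\<bar>w \<bullet> t\<bar> \<le> (\<Sum>l\<in>UNIV. \<bar>w $ l * t $ l\<bar>)"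
      unfolding inner_vec_def inner_real_def by (rule sum_abs)
    also have "\<dots> \<le> (\<Sum>l\<in>UNIV. R * \<bar>t $ l\<bar>)"
      unfolding abs_mult by (intro sum_mono mult_right_mono R(2) that) simp
    finally show ?thesis by (simp add: q_def sum_distrib_left)
  qed
  have finD: "finite (D m)" for m unfolding D_def by (rule finite_degree_eq)
  then have finE: "finite (E M)" for M by (simp add: E_def)
  have sumE: "sum f (E M) = (\<Sum>m<M. sum f (D m))" for f :: "('d \<Rightarrow> nat) \<Rightarrow> real" and M
    unfolding E_def by (rule sum.UNION_disjoint) (use finD in \<open>auto simp: D_def\<close>)
  have subE: "\<exists>M0. \<forall>M\<ge>M0. F \<subseteq> E M" if "finite F" for F
  proof (intro exI allI impI subsetI)
    fix M I assume M: "Suc (\<Sum>I\<in>F. \<Sum>l\<in>UNIV. I l) \<le> M" and "I \<in> F"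
    then have "(\<Sum>l\<in>UNIV. I l) \<le> (\<Sum>I\<in>F. \<Sum>l\<in>UNIV. I l)"
      using that by (intro member_le_sum) auto
    then show "I \<in> E M" using M by (auto simp: E_def D_def)
  qed
  have absD: "(\<Sum>I\<in>D m. \<bar>?T I\<bar>) \<le> b m" for m
  proof -
    let ?c = "fact (m + CARD('d)) / fact CARD('d) :: real"
    have "(\<Sum>I\<in>D m. \<bar>?T I\<bar>) \<le> (\<Sum>I\<in>D m. ?c * (\<Prod>l\<in>UNIV. (R * \<bar>t $ l\<bar>) ^ I l / fact (I l)))"
    proof (rule sum_mono)
      fix I assume "I \<in> D m"
      then have m: "(\<Sum>l\<in>UNIV. I l) = m" by (simp add: D_def)
      let ?a = "?c * (\<Prod>l\<in>UNIV. \<bar>t $ l\<bar> ^ I l) / (\<Prod>l\<in>UNIV. fact (I l))"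
      have "0 \<le> ?a" by (intro mult_nonneg_nonneg divide_nonneg_nonneg prod_nonneg) auto
      then have "?a * \<bar>moment P I\<bar> \<le> ?a * (\<Prod>l\<in>UNIV. R ^ I l)"
        using abs_moment_le[OF P(1) R(2) P(2)] by (intro mult_left_mono) auto
      also have "\<dots> = ?c * (\<Prod>l\<in>UNIV. (R * \<bar>t $ l\<bar>) ^ I l / fact (I l))"
        by (simp add: prod_dividef power_mult_distrib prod.distrib)
      also have "?a * \<bar>moment P I\<bar> = \<bar>?T I\<bar>"
        unfolding normalized_mgf_term_def m
        by (simp add: abs_mult abs_prod power_abs mult_ac)
      finally show "\<bar>?T I\<bar> \<le> ?c * (\<Prod>l\<in>UNIV. (R * \<bar>t $ l\<bar>) ^ I l / fact (I l))" .
    qed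
    \<comment> \<open>The multinomial theorem once more, at the numbers
      \<open>R * \<bar>t $ l\<bar>\<close>.\<close>
    also have "\<dots> = b m"
      unfolding sum_distrib_left[symmetric] D_def multinomial_formula
      by (simp add: b_def q_def binomial_fact sum_distrib_left)
    finally show ?thesis .
  qed
  have "(\<lambda>I. norm (?T I)) summable_on UNIV"
  proof (rule nonneg_bdd_above_summable_on)
    show "bdd_above (sum (\<lambda>I. norm (?T I)) ` {F. F \<subseteq> UNIV \<and> finite F})"
    proof (rule bdd_aboveI2[where M = "\<Sum>m. b m"])
      fix F :: "('d \<Rightarrow> nat) set" assume "F \<in> {F. F \<subseteq> UNIV \<and> finite F}"
      then have "finite F" by simp
      from subE[OF this] obtain M where M: "F \<subseteq> E M" by (elim exE) (meson order_refl)
      have "(\<Sum>I\<in>F. norm (?T I)) \<le> (\<Sum>I\<in>E M. \<bar>?T I\<bar>)"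
        using M finE by (simp add: sum_mono2)
      also have "\<dots> \<le> (\<Sum>m<M. b m)" unfolding sumE by (intro sum_mono absD)
      also have "\<dots> \<le> (\<Sum>m. b m)" using b b0 by (intro sum_le_suminf) auto
      finally show "(\<Sum>I\<in>F. norm (?T I)) \<le> (\<Sum>m. b m)" .
    qed
  qed auto
  then obtain s where s: "(?T has_sum s) UNIV"
    using abs_summable_summable summable_on_def by blast
  \<comment> \<open>Every finite set of exponents lies in some \<open>E M\<close>, so the partial
    sums by degree converge to the unordered sum.\<close>
  have "filterlim E (finite_subsets_at_top UNIV) sequentially"
    unfolding filterlim_finite_subsets_at_top eventually_sequentially
    using subE finE by auto
  then have "((\<lambda>M. sum ?T (E M)) \<longlongrightarrow> s) sequentially"
    using s unfolding has_sum_def by (rule filterlim_compose[rotated])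
  then have "(\<lambda>m. \<Sum>I\<in>D m. ?T I) sums s" by (simp add: sumE sums_def)
  then have 1: "(\<lambda>m. (LINT w:P|lborel. real ((m + CARD('d)) choose CARD('d)) * (w \<bullet> t) ^ m) / vol P) sums s"
    unfolding D_def sum_normalized_mgf_term_degree[OF P(1)] .
  let ?g = "\<lambda>m w. indicator P w *\<^sub>R (real ((m + CARD('d)) choose CARD('d)) * (w \<bullet> t) ^ m)"
  have gb: "norm (?g m w) \<le> indicator P w * b m" for m w
  proof (cases "w \<in> P")
    case True
    then have "\<bar>w \<bullet> t\<bar> ^ m \<le> q ^ m" by (intro power_mono inner) auto
    then show ?thesis using True by (simp add: abs_mult power_abs b_def mult_left_mono)
  qed simp
  have gi: "integrable lborel (?g m)" for m
    by (intro borel_integrable_compact P(1) continuous_intros)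
  have bi: "integrable lborel (\<lambda>w. indicator P w * b m)" for m
    using borel_integrable_compact[OF P(1), of "\<lambda>_. b m"] by simp
  \<comment> \<open>Integration term by term: on \<open>P\<close> the m-th term is at most
    \<open>b m\<close> in absolute value, and \<open>P\<close> has finite volume.\<close>
  have "(\<lambda>m. \<integral>w. ?g m w \<partial>lborel) sums (\<integral>w. (\<Sum>m. ?g m w) \<partial>lborel)"
  proof (rule sums_integral[OF gi])
    have "norm (?g m w) \<le> b m" for m w
      using gb[where m = m and w = w] b0[of m] by (auto simp: indicator_def split: if_splits)
    then show "AE w in lborel. summable (\<lambda>m. norm (?g m w))"
      by (intro AE_I2 summable_comparison_test'[OF b, of 0]) simp
    have "(\<integral>w. norm (?g m w) \<partial>lborel) \<le> b m * vol P" for m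
    proof -
      have "(\<integral>w. norm (?g m w) \<partial>lborel) \<le> (\<integral>w. indicator P w * b m \<partial>lborel)"
        by (intro integral_mono gi integrable_norm bi gb)
      then show ?thesis by (simp add: mult.commute)
    qed
    then show "summable (\<lambda>m. \<integral>w. norm (?g m w) \<partial>lborel)"
      by (intro summable_comparison_test'[OF summable_mult2[OF b, of "vol P"], of 0]) simp
  qed
  also have "(\<lambda>w. \<Sum>m. ?g m w) = (\<lambda>w. indicator P w *\<^sub>R (1 / (1 - w \<bullet> t) ^ (CARD('d) + 1)))"
  proof
    fix w
    show "(\<Sum>m. ?g m w) = indicator P w *\<^sub>R (1 / (1 - w \<bullet> t) ^ (CARD('d) + 1))"
    proof (cases "w \<in> P")
      case True
      then have "\<bar>w \<bullet> t\<bar> < 1" using inner q by fastforce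
      from negative_binomial_sums[OF this, of "CARD('d)"] True show ?thesis
        by (simp add: sums_iff)
    qed simp
  qed
  finally have "(\<lambda>m. LINT w:P|lborel. real ((m + CARD('d)) choose CARD('d)) * (w \<bullet> t) ^ m)
    sums (LINT w:P|lborel. 1 / (1 - w \<bullet> t) ^ (CARD('d) + 1))"
    by (simp only: set_lebesgue_integral_def)
  from sums_unique2[OF 1 sums_divide[OF this, of "vol P"]] s show ?thesis by simp
qed

text \<open>The neighbourhood of 0 comes from a bound on \<open>P\<close> alone and is fixed before
  \<open>\<Sigma>\<close>; one neighbourhood thus serves all triangulations, and their sums can be
  compared there.\<close>

lemma triangulates_has_sum:
  fixes P :: "(real ^ 'd) set" and X :: "real ^ 'd ^ 'n"
  assumes "compact P" "vol P > 0" "inj (\<lambda>k. X $ k)" "\<And>k. X $ k \<in> P"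
  shows "\<forall>\<^sub>F t in nhds 0. \<forall>\<Sigma>. triangulates X \<Sigma> P \<longrightarrow>
    (normalized_mgf_term P t has_sum triangulation_sum X \<Sigma> P t) UNIV"
proof -
  obtain R where R: "R > 0" "\<And>w. w \<in> P \<Longrightarrow> norm w \<le> R"
    using compact_imp_bounded[OF assms(1)] by (auto simp: bounded_pos)
  have comp: "\<bar>w $ l\<bar> \<le> R" if "w \<in> P" for w l
    using R(2)[OF that] component_le_norm_cart[of w l] by linarith
  let ?U = "{t :: real ^ 'd. R * (\<Sum>l\<in>UNIV. \<bar>t $ l\<bar>) < 1}"
  have "open ?U" by (intro open_Collect_less continuous_intros)
  then have "\<forall>\<^sub>F t in nhds 0. t \<in> ?U" by (intro eventually_nhds_in_open) auto
  then show ?thesis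
  proof eventually_elim
    case (elim t)
    have lt: "w \<bullet> t < 1" if "w \<in> P" for w
    proof -
      have "w \<bullet> t \<le> (\<Sum>l\<in>UNIV. R * \<bar>t $ l\<bar>)"
        unfolding inner_vec_def inner_real_def
      proof (rule sum_mono)
        fix l
        have "w $ l * t $ l \<le> \<bar>w $ l\<bar> * \<bar>t $ l\<bar>" by (metis abs_ge_self abs_mult)
        also have "\<dots> \<le> R * \<bar>t $ l\<bar>" by (intro mult_right_mono comp that) simp
        finally show "w $ l * t $ l \<le> R * \<bar>t $ l\<bar>" .
      qed
      then show ?thesis using elim by (simp add: sum_distrib_left)
    qed
    have "(normalized_mgf_term P t has_sum
      (LINT w:P|lborel. 1 / (1 - w \<bullet> t) ^ (CARD('d) + 1)) / vol P) UNIV"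
      using elim R(1) comp by (intro has_sum_normalized_mgf_term assms(1,2)) auto
    moreover have "(LINT w:P|lborel. 1 / (1 - w \<bullet> t) ^ (CARD('d) + 1)) / vol P = triangulation_sum X \<Sigma> P t"
      if "triangulates X \<Sigma> P" for \<Sigma>
      using integral_proj_kernel_triangulates[OF that assms(3) _ lt[OF assms(4)]] assms(2) by simp
    ultimately show ?case by metis
  qed
qed

text \<open>
  After clearing denominators both sums become polynomials in \<open>s\<close> along the line \<open>s t\<close>;
  these agree for small \<open>s\<close> because the moments do not depend on the triangulation.
\<close>

lemma triangulation_sum_unique:
  fixes P :: "(real ^ 'd) set" and X :: "real ^ 'd ^ 'n"
  assumes "compact P" "vol P > 0" "inj (\<lambda>k. X $ k)" "\<And>k. X $ k \<in> P"
    and "triangulates X \<Sigma> P" "triangulates X \<Sigma>' P"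
    and "\<And>k. X $ k \<bullet> t \<noteq> 1"
  shows "triangulation_sum X \<Sigma> P t = triangulation_sum X \<Sigma>' P t"
proof -
  \<comment> \<open>For each simplex, the linear factors of the rows outside it: the numerators over
    the common denominator \<open>D\<close>, as polynomials in s.\<close>
  define Q where "Q = (\<lambda>\<Sigma>. \<Sum>\<sigma>\<in>\<Sigma>. smult (vol (conv_rows X \<sigma>)) (\<Prod>k\<in>UNIV - \<sigma>. [:1, - (X $ k \<bullet> t):]))"
  define D where "D = (\<lambda>s. \<Prod>k\<in>UNIV. 1 - s * (X $ k \<bullet> t))"
  have Q: "poly (Q \<Sigma>) s = D s * (vol P * triangulation_sum X \<Sigma> P (s *\<^sub>R t))"
    if "\<And>k. s * (X $ k \<bullet> t) \<noteq> 1" for s \<Sigma>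
  proof -
    have "(\<Prod>k\<in>UNIV - \<sigma>. 1 - s * (X $ k \<bullet> t)) = D s / (\<Prod>k\<in>\<sigma>. 1 - s * (X $ k \<bullet> t))" for \<sigma>
    proof -
      have "(\<Prod>k\<in>\<sigma>. 1 - s * (X $ k \<bullet> t)) \<noteq> 0" using that by (simp add: prod_zero_iff)
      moreover have "D s = (\<Prod>k\<in>UNIV - \<sigma>. 1 - s * (X $ k \<bullet> t)) * (\<Prod>k\<in>\<sigma>. 1 - s * (X $ k \<bullet> t))"
        unfolding D_def by (rule prod.subset_diff) auto
      ultimately show ?thesis by simp
    qed
    moreover have "(\<Sum>l\<in>UNIV. X $ k $ l * (s *\<^sub>R t) $ l) = s * (X $ k \<bullet> t)" for k
      by (simp add: inner_vec_def sum_distrib_left mult_ac)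
    ultimately show ?thesis
      using assms(2)
      by (simp add: Q_def poly_sum poly_prod triangulation_sum_def sum_distrib_left mult_ac)
  qed
  have "((\<lambda>s. s *\<^sub>R t) \<longlongrightarrow> 0 *\<^sub>R t) (nhds 0)" 
    by (intro tendsto_intros) (simp add: filterlim_ident)
  then have lim: "filterlim (\<lambda>s. s *\<^sub>R t) (nhds 0) (nhds (0::real))" by simp
  have "\<forall>\<^sub>F u in nhds 0. triangulation_sum X \<Sigma> P u = triangulation_sum X \<Sigma>' P u"
    using triangulates_has_sum[OF assms(1-4)]
    by eventually_elim (use assms(5,6) has_sum_unique in metis)
  then have "\<forall>\<^sub>F s in nhds 0. triangulation_sum X \<Sigma> P (s *\<^sub>R t) = triangulation_sum X \<Sigma>' P (s *\<^sub>R t)"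
    using lim by (rule eventually_compose_filterlim)
  moreover have "\<forall>\<^sub>F s in nhds (0::real). \<forall>k. s * (X $ k \<bullet> t) \<noteq> 1"
  proof (rule eventually_all_finite)
    fix k
    have "open {s. s * (X $ k \<bullet> t) \<noteq> 1}" by (intro open_Collect_neq continuous_intros)
    then have "\<forall>\<^sub>F s in nhds 0. s \<in> {s. s * (X $ k \<bullet> t) \<noteq> 1}"
      by (intro eventually_nhds_in_open) auto
    then show "\<forall>\<^sub>F s in nhds 0. s * (X $ k \<bullet> t) \<noteq> 1" by simp
  qed
  ultimately have "\<forall>\<^sub>F s in nhds 0. poly (Q \<Sigma> - Q \<Sigma>') s = 0"
    by eventually_elim (simp add: Q)
  then obtain e where e: "e > 0" "\<And>s. dist s 0 < e \<Longrightarrow> poly (Q \<Sigma> - Q \<Sigma>') s = 0"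
    unfolding eventually_nhds_metric by blast
  have "infinite {0<..<e}" using e(1) by (simp add: infinite_Ioo)
  moreover have "{0<..<e} \<subseteq> {s. poly (Q \<Sigma> - Q \<Sigma>') s = 0}"
    by (intro subsetI CollectI e(2)) (simp add: dist_real_def)
  ultimately have "Q \<Sigma> - Q \<Sigma>' = 0"
    using poly_roots_finite finite_subset by blast
  \<comment> \<open>At s = 1 the line reaches \<open>t\<close> itself, and there the common
    denominator can be cancelled.\<close>
  moreover have "D 1 \<noteq> 0" using assms(7) by (simp add: D_def prod_zero_iff)
  ultimately show ?thesis using Q[of 1 \<Sigma>] Q[of 1 \<Sigma>'] assms(2,7) by simp
qed

section \<open>Homogeneous polynomials\<close>

definition exp_degree :: "('n::finite \<Rightarrow> 'd::finite \<Rightarrow> nat) \<Rightarrow> nat" where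
  "exp_degree a = (\<Sum>k\<in>UNIV. \<Sum>l\<in>UNIV. a k l)"

definition mat_monom :: "('n \<Rightarrow> 'd \<Rightarrow> nat) \<Rightarrow> real ^ 'd ^ 'n \<Rightarrow> real" where
  "mat_monom a X = (\<Prod>k\<in>UNIV. \<Prod>l\<in>UNIV. (X $ k $ l) ^ a k l)"

text \<open>A homogeneous polynomial in the matrix with coefficients depending continuously on a
  parameter. The parameter is to be the point of the standard simplex over which one integrates, and
  continuity makes the coefficients integrable.\<close>

definition homogeneous_family :: "nat \<Rightarrow> ('p::topological_space \<Rightarrow> real ^ 'd ^ 'n \<Rightarrow> real) \<Rightarrow> bool" where
  "homogeneous_family m f \<longleftrightarrow> (\<exists>c. (\<forall>a. continuous_on UNIV (c a)) \<and>
     (\<forall>x X. f x X = (\<Sum>a | exp_degree a = m. c a x * mat_monom a X)))"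

lemma finite_exp_degree: "finite {a :: 'n::finite \<Rightarrow> 'd::finite \<Rightarrow> nat. exp_degree a = m}"
proof (rule finite_subset)
  show "{a :: 'n \<Rightarrow> 'd \<Rightarrow> nat. exp_degree a = m} \<subseteq> Pi\<^sub>E UNIV (\<lambda>_. Pi\<^sub>E UNIV (\<lambda>_. {..m}))"
  proof
    fix a :: "'n \<Rightarrow> 'd \<Rightarrow> nat" assume a: "a \<in> {a. exp_degree a = m}"
    have "a k l \<le> m" for k l
    proof -
      have "a k l \<le> (\<Sum>l\<in>UNIV. a k l)" by (rule member_le_sum) auto
      also have "\<dots> \<le> (\<Sum>k\<in>UNIV. \<Sum>l\<in>UNIV. a k l)"
        by (rule member_le_sum[where f = "\<lambda>k. \<Sum>l\<in>UNIV. a k l"]) auto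
      finally show ?thesis using a by (simp add: exp_degree_def)
    qed
    then show "a \<in> Pi\<^sub>E UNIV (\<lambda>_. Pi\<^sub>E UNIV (\<lambda>_. {..m}))" by (simp add: PiE_UNIV_domain)
  qed
qed (intro finite_PiE; simp)+

text \<open>Several indices \<open>j\<close> may carry the same exponent matrix; their coefficients
  are added up.\<close>

lemma homogeneous_familyI:
  assumes "finite J" "\<And>j. j \<in> J \<Longrightarrow> continuous_on UNIV (c j)" "\<And>j. j \<in> J \<Longrightarrow> exp_degree (e j) = m"
    and "\<And>x X. f x X = (\<Sum>j\<in>J. c j x * mat_monom (e j) X)"
  shows "homogeneous_family m f"
  unfolding homogeneous_family_def
proof (intro exI conjI allI)
  fix x X
  have "f x X = (\<Sum>a | exp_degree a = m. \<Sum>j | j \<in> J \<and> e j = a. c j x * mat_monom (e j) X)"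
    unfolding assms(4) by (rule sum.group[symmetric]) (use assms(1,3) finite_exp_degree in auto)
  also have "\<dots> = (\<Sum>a | exp_degree a = m. (\<Sum>j | j \<in> J \<and> e j = a. c j x) * mat_monom a X)"
    unfolding sum_distrib_right by (intro sum.cong) auto
  finally show "f x X = (\<Sum>a | exp_degree a = m. (\<Sum>j | j \<in> J \<and> e j = a. c j x) * mat_monom a X)" .
qed (use assms(2) in \<open>auto intro!: continuous_intros\<close>)

lemma mat_monom_add: "mat_monom (\<lambda>k l. a k l + b k l) X = mat_monom a X * mat_monom b X"
  by (simp add: mat_monom_def power_add prod.distrib)

lemma exp_degree_add: "exp_degree (\<lambda>k l. a k l + b k l) = exp_degree a + exp_degree b"
  by (simp add: exp_degree_def sum.distrib)

lemma homogeneous_family_coeff: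
  assumes "continuous_on UNIV g"
  shows "homogeneous_family 0 (\<lambda>x (_ :: real ^ 'd ^ 'n). g x)"
  by (rule homogeneous_familyI[of "{()}" "\<lambda>_. g" "\<lambda>_ _ _. 0"])
     (use assms in \<open>auto simp: mat_monom_def exp_degree_def\<close>)

lemma homogeneous_family_entry: "homogeneous_family 1 (\<lambda>_ X. X $ k $ l)"
proof (rule homogeneous_familyI[of "{()}" "\<lambda>_ _. 1" "\<lambda>_ k' l'. if k' = k \<and> l' = l then 1 else 0"])
  fix X :: "real ^ 'b ^ 'c"
  have "(\<Prod>l'\<in>UNIV. X $ k' $ l' ^ (if k' = k \<and> l' = l then 1 else 0)) = (if k' = k then X $ k $ l else 1)" for k'
  proof (cases "k' = k")
    case True
    have "(\<Prod>l'\<in>UNIV. X $ k' $ l' ^ (if k' = k \<and> l' = l then 1 else 0)) = (\<Prod>l'\<in>UNIV. if l' = l then X $ k $ l else 1)"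
      using True by (intro prod.cong) auto
    then show ?thesis using True by simp
  qed simp
  then have "mat_monom (\<lambda>k' l'. if k' = k \<and> l' = l then 1 else 0) X = X $ k $ l"
    by (simp add: mat_monom_def)
  then show "X $ k $ l = (\<Sum>j\<in>{()}. 1 * mat_monom (\<lambda>k' l'. if k' = k \<and> l' = l then 1 else 0) X)"
    by simp
next
  have "(\<Sum>l'\<in>UNIV. if k' = k \<and> l' = l then 1 else 0) = (if k' = k then 1 else (0::nat))" for k'
    by (cases "k' = k") simp_all
  then show "exp_degree (\<lambda>k' l'. if k' = k \<and> l' = l then 1 else 0) = 1"
    by (simp add: exp_degree_def)
qed auto

lemma homogeneous_family_add:
  assumes "homogeneous_family m f" "homogeneous_family m g"
  shows "homogeneous_family m (\<lambda>x X. f x X + g x X)"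
proof -
  obtain c d where "\<And>a. continuous_on UNIV (c a)" "\<And>a. continuous_on UNIV (d a)"
    "\<And>x X. f x X = (\<Sum>a | exp_degree a = m. c a x * mat_monom a X)"
    "\<And>x X. g x X = (\<Sum>a | exp_degree a = m. d a x * mat_monom a X)"
    using assms unfolding homogeneous_family_def by blast
  then show ?thesis
    unfolding homogeneous_family_def
    by (intro exI[of _ "\<lambda>a x. c a x + d a x"])
       (auto simp: distrib_right sum.distrib intro!: continuous_intros)
qed

lemma homogeneous_family_mult:
  assumes "homogeneous_family m f" "homogeneous_family n g"
  shows "homogeneous_family (m + n) (\<lambda>x X. f x X * g x X)"
proof -
  obtain c d where c: "\<And>a. continuous_on UNIV (c a)" "\<And>a. continuous_on UNIV (d a)"
    "\<And>x X. f x X = (\<Sum>a | exp_degree a = m. c a x * mat_monom a X)"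
    "\<And>x X. g x X = (\<Sum>a | exp_degree a = n. d a x * mat_monom a X)"
    using assms unfolding homogeneous_family_def by blast
  show ?thesis
  proof (rule homogeneous_familyI[of "{a. exp_degree a = m} \<times> {b. exp_degree b = n}"
        "\<lambda>(a, b) x. c a x * d b x" "\<lambda>(a, b) k l. a k l + b k l"])
    fix x X
    show "f x X * g x X = (\<Sum>j\<in>{a. exp_degree a = m} \<times> {b. exp_degree b = n}.
      (case j of (a, b) \<Rightarrow> \<lambda>x. c a x * d b x) x * mat_monom (case j of (a, b) \<Rightarrow> \<lambda>k l. a k l + b k l) X)"
      unfolding c(3,4) sum_product sum.cartesian_product
      by (intro sum.cong) (auto simp: mat_monom_add)
  qed (use c(1,2) in \<open>auto simp: exp_degree_add finite_exp_degree intro!: continuous_intros\<close>)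
qed

lemma homogeneous_family_zero: "homogeneous_family m (\<lambda>_ _. 0)"
  by (rule homogeneous_familyI[of "{}"]) auto

lemma homogeneous_family_sum:
  assumes "\<And>i. i \<in> A \<Longrightarrow> homogeneous_family m (f i)"
  shows "homogeneous_family m (\<lambda>x X. \<Sum>i\<in>A. f i x X)"
  using assms
proof (induction A rule: infinite_finite_induct)
  case (insert i A)
  then show ?case using homogeneous_family_add[of m "f i" "\<lambda>x X. \<Sum>i\<in>A. f i x X"] by simp
qed (simp_all add: homogeneous_family_zero)

lemma homogeneous_family_prod:
  assumes "\<And>i. i \<in> A \<Longrightarrow> homogeneous_family (m i) (f i)" "finite A"
  shows "homogeneous_family (\<Sum>i\<in>A. m i) (\<lambda>x X. \<Prod>i\<in>A. f i x X)"
  using assms(2,1)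
proof (induction A rule: finite_induct)
  case (insert i A)
  then show ?case
    using homogeneous_family_mult[of "m i" "f i" "\<Sum>i\<in>A. m i" "\<lambda>x X. \<Prod>i\<in>A. f i x X"] by simp
qed (simp add: homogeneous_family_coeff)

lemma homogeneous_family_power:
  assumes "homogeneous_family 1 f"
  shows "homogeneous_family r (\<lambda>x X. f x X ^ r)"
proof (induction r)
  case 0
  show ?case by (simp add: homogeneous_family_coeff)
next
  case (Suc r)
  from homogeneous_family_mult[OF assms Suc] show ?case by simp
qed

lemma homogeneous_family_scale:
  assumes "homogeneous_family m f" "continuous_on UNIV g"
  shows "homogeneous_family m (\<lambda>x X. g x * f x X)"
  using homogeneous_family_mult[OF homogeneous_family_coeff[OF assms(2)] assms(1)] by simp

lemma homogeneous_family_diff: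
  assumes "homogeneous_family m f" "homogeneous_family m g"
  shows "homogeneous_family m (\<lambda>x X. f x X - g x X)"
  using homogeneous_family_add[OF assms(1) homogeneous_family_scale[OF assms(2), of "\<lambda>_. -1"]] by simp

lemma homogeneous_family_det:
  fixes f :: "'e::finite \<Rightarrow> 'e \<Rightarrow> 'p::topological_space \<Rightarrow> real ^ 'd ^ 'n \<Rightarrow> real"
  assumes "\<And>i j. homogeneous_family 1 (f i j)"
  shows "homogeneous_family CARD('e) (\<lambda>x X. det (\<chi> i j. f i j x X))"
  unfolding det_def
proof (intro homogeneous_family_sum homogeneous_family_scale)
  fix p :: "'e \<Rightarrow> 'e"
  show "homogeneous_family CARD('e) (\<lambda>x X. \<Prod>i\<in>UNIV. (\<chi> i j. f i j x X) $ i $ p i)"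
    using homogeneous_family_prod[of UNIV "\<lambda>_. 1" "\<lambda>i. f i (p i)"] assms by simp
qed simp

lemma homogeneous_polynomial_altdef:
  "homogeneous_polynomial m f \<longleftrightarrow> (\<exists>c. \<forall>X. f X = (\<Sum>a | exp_degree a = m. c a * mat_monom a X))"
  unfolding homogeneous_polynomial_def exp_degree_def mat_monom_def ..

lemma homogeneous_family_of_polynomial:
  "homogeneous_polynomial m f \<Longrightarrow> homogeneous_family m (\<lambda>_. f)"
  unfolding homogeneous_polynomial_altdef homogeneous_family_def
  by (elim exE, rule_tac x = "\<lambda>a _. c a" in exI) simp

lemma homogeneous_polynomial_of_family:
  "homogeneous_family m f \<Longrightarrow> homogeneous_polynomial m (f x)"
  unfolding homogeneous_polynomial_altdef homogeneous_family_def by fastforce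

text \<open>Integration over the parameter acts on the coefficients and leaves the monomials in X
  untouched, so the degree survives.\<close>

lemma homogeneous_polynomial_integral:
  fixes f :: "'p::euclidean_space \<Rightarrow> real ^ 'd ^ 'n \<Rightarrow> real"
  assumes "homogeneous_family m f" "compact S"
  shows "homogeneous_polynomial m (\<lambda>X. LINT x:S|lborel. f x X)"
proof -
  obtain c where c: "\<And>a. continuous_on UNIV (c a)"
    "\<And>x X. f x X = (\<Sum>a | exp_degree a = m. c a x * mat_monom a X)"
    using assms unfolding homogeneous_family_def by blast
  have "(LINT x:S|lborel. f x X) = (\<Sum>a | exp_degree a = m. (LINT x:S|lborel. c a x) * mat_monom a X)" for X
    unfolding c(2) using c(1)
    by (subst set_integral_sum_compact[OF assms(2)]) (auto intro!: continuous_intros continuous_on_subset[OF c(1)])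
  then show ?thesis
    unfolding homogeneous_polynomial_altdef by (intro exI allI)
qed

lemma homogeneous_polynomial_continuous:
  assumes "homogeneous_polynomial m f"
  shows "continuous_on UNIV f"
proof -
  obtain c where "f = (\<lambda>X. \<Sum>a | exp_degree a = m. c a * mat_monom a X)"
    using assms unfolding homogeneous_polynomial_altdef by blast
  then show ?thesis unfolding mat_monom_def by (auto intro!: continuous_intros)
qed

section \<open>Facets and cones from the centroid\<close>

definition row_labels :: "real ^ 'd ^ 'n \<Rightarrow> (real ^ 'd) set \<Rightarrow> 'n set" where
  "row_labels X F = {k. X $ k \<in> F}"

definition facet_labels :: "real ^ 'd ^ 'n \<Rightarrow> 'n set set" where
  "facet_labels X = {row_labels X F | F. F facet_of conv_rows X UNIV}"

definition centroid :: "real ^ 'd ^ 'n \<Rightarrow> real ^ 'd" where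
  "centroid X = (1 / real CARD('n)) *\<^sub>R (\<Sum>k\<in>UNIV. X $ k)"

lemma polytope_conv_rows: "polytope (conv_rows X \<sigma>)" for X :: "real ^ 'd ^ 'n"
  unfolding conv_rows_def by (intro polytope_convex_hull) simp

lemma convex_conv_rows: "convex (conv_rows X \<sigma>)"
  by (simp add: conv_rows_def)

lemma row_in_conv_rows: "k \<in> \<sigma> \<Longrightarrow> X $ k \<in> conv_rows X \<sigma>"
  unfolding conv_rows_def by (intro hull_inc) auto

text \<open>A face of the hull of finitely many points is the hull of some of them. Hence a face is
  determined by its labels.\<close>

lemma face_eq_conv_rows:
  fixes X :: "real ^ 'd ^ 'n"
  assumes "F face_of conv_rows X UNIV"
  shows "F = conv_rows X (row_labels X F)"
proof
  have "compact (range (\<lambda>k. X $ k))" by (intro finite_imp_compact) simp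
  from face_of_convex_hull_subset[OF this assms[unfolded conv_rows_def]]
  obtain S where S: "S \<subseteq> range (\<lambda>k. X $ k)" "F = convex hull S" .
  then have "S \<subseteq> (\<lambda>k. X $ k) ` row_labels X F"
    by (auto simp: row_labels_def intro: hull_inc)
  then show "F \<subseteq> conv_rows X (row_labels X F)"
    unfolding conv_rows_def using S(2) hull_mono by metis
  show "conv_rows X (row_labels X F) \<subseteq> F"
    unfolding conv_rows_def using face_of_imp_convex[OF assms]
    by (intro hull_minimal) (auto simp: row_labels_def)
qed

lemma row_labels_mono: "F \<subseteq> G \<Longrightarrow> row_labels X F \<subseteq> row_labels X G"
  by (auto simp: row_labels_def)

lemma row_labels_subset_iff:
  fixes X :: "real ^ 'd ^ 'n"
  assumes "F face_of conv_rows X UNIV" "G face_of conv_rows X UNIV"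
  shows "row_labels X F \<subseteq> row_labels X G \<longleftrightarrow> F \<subseteq> G"
proof
  assume "row_labels X F \<subseteq> row_labels X G"
  then have "conv_rows X (row_labels X F) \<subseteq> conv_rows X (row_labels X G)"
    unfolding conv_rows_def by (intro hull_mono image_mono)
  then show "F \<subseteq> G" using face_eq_conv_rows assms by metis
qed (rule row_labels_mono)

lemma row_labels_eq_UNIV_iff:
  fixes X :: "real ^ 'd ^ 'n"
  assumes "F face_of conv_rows X UNIV"
  shows "row_labels X F = UNIV \<longleftrightarrow> F = conv_rows X UNIV"
  using face_eq_conv_rows[OF assms] row_in_conv_rows[of _ UNIV X] by (auto simp: row_labels_def)

lemma labeled_face_lattice_altdef:
  "labeled_face_lattice X = {row_labels X F | F. F face_of conv_rows X UNIV}"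
  unfolding labeled_face_lattice_def row_labels_def ..

text \<open>
  Facets are the maximal proper faces, so the face lattice determines the labels of the facets.
\<close>

lemma facet_labels_eq_maximal:
  fixes X :: "real ^ 'd ^ 'n"
  assumes dim: "aff_dim (conv_rows X UNIV) = int CARD('d)"
  shows "facet_labels X = {L \<in> labeled_face_lattice X. L \<noteq> UNIV \<and>
    (\<forall>M\<in>labeled_face_lattice X. L \<subset> M \<longrightarrow> M = UNIV)}"
proof (intro set_eqI iffI)
  let ?Q = "conv_rows X UNIV"
  have cQ: "convex ?Q" by (rule convex_conv_rows)
  fix L assume "L \<in> facet_labels X"
  then obtain F where F: "F facet_of ?Q" "L = row_labels X F"
    unfolding facet_labels_def by blast
  have face: "F face_of ?Q" and dF: "aff_dim F = int CARD('d) - 1"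
    using F(1) dim by (auto simp: facet_of_def)
  have "F \<noteq> ?Q" using dF dim by auto
  then have "L \<noteq> UNIV" using row_labels_eq_UNIV_iff[OF face] F(2) by simp
  moreover have "M = UNIV" if M: "M \<in> labeled_face_lattice X" "L \<subset> M" for M
  proof (rule ccontr)
    assume neq: "M \<noteq> UNIV"
    obtain G where G: "G face_of ?Q" "M = row_labels X G"
      using M(1) unfolding labeled_face_lattice_altdef by blast
    \<comment> \<open>A face strictly between the facet and the polytope would have dimension
      strictly between d - 1 and d.\<close>
    have "F \<subseteq> G" "F \<noteq> G" using M(2) row_labels_subset_iff[OF face G(1)] F(2) G(2) by auto
    then have "aff_dim F < aff_dim G"
      using face_of_aff_dim_lt[OF face_of_imp_convex[OF G(1)]] face_of_subset[OF face _ face_of_imp_subset[OF G(1)]]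
      by blast
    moreover have "aff_dim G < aff_dim ?Q"
      using face_of_aff_dim_lt[OF cQ G(1)] row_labels_eq_UNIV_iff[OF G(1)] neq G(2) by blast
    ultimately show False using dF dim by simp
  qed
  ultimately show "L \<in> {L \<in> labeled_face_lattice X. L \<noteq> UNIV \<and>
    (\<forall>M\<in>labeled_face_lattice X. L \<subset> M \<longrightarrow> M = UNIV)}"
    using face F(2) unfolding labeled_face_lattice_altdef by blast
next
  let ?Q = "conv_rows X UNIV"
  have poly: "polyhedron ?Q" by (intro polytope_imp_polyhedron polytope_conv_rows)
  fix L assume "L \<in> {L \<in> labeled_face_lattice X. L \<noteq> UNIV \<and>
    (\<forall>M\<in>labeled_face_lattice X. L \<subset> M \<longrightarrow> M = UNIV)}"
  then have L: "L \<in> labeled_face_lattice X" "L \<noteq> UNIV"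
    and max: "\<And>M. M \<in> labeled_face_lattice X \<Longrightarrow> L \<subset> M \<Longrightarrow> M = UNIV"
    by simp_all
  from L obtain F where F: "F face_of ?Q" "L = row_labels X F" "L \<noteq> UNIV"
    unfolding labeled_face_lattice_altdef by blast
  have max': "F = G" if G: "G facet_of ?Q" "F \<subseteq> G" for G
  proof (rule ccontr)
    assume "F \<noteq> G"
    have face: "G face_of ?Q" and "G \<noteq> ?Q" using G(1) by (auto simp: facet_of_def)
    then have "row_labels X G \<noteq> UNIV" using row_labels_eq_UNIV_iff by blast
    moreover have "L \<subset> row_labels X G"
      using row_labels_subset_iff[OF F(1) face] row_labels_subset_iff[OF face F(1)] G(2) F(2) \<open>F \<noteq> G\<close>
      by blast
    ultimately show False using max face unfolding labeled_face_lattice_altdef by blast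
  qed
  have "F \<noteq> ?Q" using F row_labels_eq_UNIV_iff by blast
  \<comment> \<open>The empty set is a face too. It is not maximal: a vertex is a proper face
    because d is positive, and it lies in a facet.\<close>
  have "F \<noteq> {}"
  proof
    assume "F = {}"
    have "?Q \<noteq> {}" using row_in_conv_rows[of _ UNIV X] by blast
    then obtain x where x: "x extreme_point_of ?Q"
      using extreme_point_exists_convex[OF compact_conv_rows convex_conv_rows] by blast
    then have "{x} face_of ?Q" by (simp add: face_of_singleton)
    moreover have "{x} \<noteq> ?Q" using dim aff_dim_sing[of x] by (metis of_nat_0_eq_iff zero_less_card_finite less_irrefl)
    ultimately obtain G where "G facet_of ?Q" "{x} \<subseteq> G"
      using face_of_polyhedron_subset_facet[OF poly, of "{x}"] by blast
    then show False using max'[of G] \<open>F = {}\<close> by simp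
  qed
  then obtain G where "G facet_of ?Q" "F \<subseteq> G"
    using face_of_polyhedron_subset_facet[OF poly F(1)] \<open>F \<noteq> ?Q\<close> by blast
  then show "L \<in> facet_labels X" using max' F(2) unfolding facet_labels_def by blast
qed

text \<open>Every point of \<open>Q\<close> lies on a segment from \<open>p\<close> to the relative
  frontier, and the far end of that segment belongs to a facet.\<close>

lemma polytope_eq_Union_cones:
  fixes Q :: "'a::euclidean_space set"
  assumes "polytope Q" "p \<in> interior Q"
  shows "Q = (\<Union>F\<in>{F. F facet_of Q}. convex hull (insert p F))"
proof
  have p: "p \<in> rel_interior Q" using assms(2) interior_subset_rel_interior by blast
  have cQ: "convex Q" "bounded Q" using assms(1) by (simp_all add: polytope_imp_convex polytope_imp_bounded)
  have sing: "Q \<noteq> {p}" using assms(2) by (auto simp: interior_singleton)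
  show "Q \<subseteq> (\<Union>F\<in>{F. F facet_of Q}. convex hull (insert p F))"
  proof
    fix x assume "x \<in> Q"
    then obtain z where z: "z \<in> rel_frontier Q" "x \<in> closed_segment p z"
      using segment_to_rel_frontier[OF cQ p, of x] sing by blast
    then obtain F where F: "F facet_of Q" "z \<in> F"
      using rel_frontier_of_polyhedron[OF polytope_imp_polyhedron[OF assms(1)]] by blast
    have "closed_segment p z \<subseteq> convex hull (insert p F)"
      unfolding segment_convex_hull using F(2) by (intro hull_mono) auto
    then show "x \<in> (\<Union>F\<in>{F. F facet_of Q}. convex hull (insert p F))" using z(2) F(1) by blast
  qed
  have "p \<in> Q" using assms(2) interior_subset by blast
  then show "(\<Union>F\<in>{F. F facet_of Q}. convex hull (insert p F)) \<subseteq> Q"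
    using cQ(1) facet_of_imp_subset by (intro UN_least hull_minimal) fastforce+
qed

text \<open>The cones meet in the cone over \<open>F \<inter> G\<close>. This intersection is a
  proper face of \<open>F\<close>, so its dimension is at most dim Q - 2, and the apex raises it by
  at most one.\<close>

lemma negligible_cone_Int_cone:
  fixes Q :: "'a::euclidean_space set"
  assumes "polytope Q" "p \<in> interior Q" "F facet_of Q" "G facet_of Q" "F \<noteq> G"
  shows "negligible (convex hull (insert p F) \<inter> convex hull (insert p G))"
proof -
  have p: "p \<in> rel_interior Q" using assms(2) interior_subset_rel_interior by blast
  have cQ: "convex Q" using assms(1) by (rule polytope_imp_convex)
  have face: "F face_of Q" "G face_of Q" using assms(3,4) by (auto simp: facet_of_def)
  have dim: "aff_dim F = aff_dim Q - 1" "aff_dim G = aff_dim Q - 1"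
    using assms(3,4) by (auto simp: facet_of_def)
  have front: "F \<subseteq> rel_frontier Q" "G \<subseteq> rel_frontier Q"
    using rel_frontier_of_polyhedron[OF polytope_imp_polyhedron[OF assms(1)]] assms(3,4) by auto
  have conv: "convex F" "convex G" using face by (simp_all add: face_of_imp_convex)
  have "F \<inter> G \<noteq> F"
  proof
    assume "F \<inter> G = F"
    then have "F \<subseteq> G" by blast
    then have "F face_of G" using face face_of_subset face_of_imp_subset by blast
    then show False using face_of_aff_dim_lt[OF conv(2)] assms(5) dim by fastforce
  qed
  moreover have "(F \<inter> G) face_of F"
    using face_of_subset[OF face_of_Int[OF face]] face_of_imp_subset[OF face(1)] by blast
  ultimately have "aff_dim (F \<inter> G) < aff_dim F"
    using face_of_aff_dim_lt[OF conv(1)] by blast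
  then have *: "aff_dim (insert p (F \<inter> G)) < int DIM('a)"
    using dim aff_dim_le_DIM[of Q] by (simp add: aff_dim_insert)
  show ?thesis
    unfolding convex_hull_insert_Int_eq[OF p front cQ conv]
    by (intro negligible_convex_lowdim) (simp_all only: convex_convex_hull aff_dim_convex_hull *)
qed

text \<open>If the centroid lay on a facet, the inequality of the facet would be tight on average
  over the rows, hence at every row, and the facet would be the whole polytope.\<close>

lemma centroid_in_interior:
  fixes X :: "real ^ 'd ^ 'n"
  assumes dim: "aff_dim (conv_rows X UNIV) = int CARD('d)"
  shows "centroid X \<in> interior (conv_rows X UNIV)"
proof -
  let ?Q = "conv_rows X UNIV"
  have in_Q: "centroid X \<in> ?Q"
  proof -
    have "(\<Sum>k\<in>UNIV. (1 / real CARD('n)) *\<^sub>R X $ k) \<in> ?Q"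
      by (rule convex_sum) (auto simp: convex_conv_rows row_in_conv_rows)
    then show ?thesis by (simp add: centroid_def scaleR_right.sum)
  qed
  have poly: "polyhedron ?Q" by (intro polytope_imp_polyhedron polytope_conv_rows)
  have "centroid X \<in> rel_interior ?Q"
  proof (rule ccontr)
    assume "centroid X \<notin> rel_interior ?Q"
    then have "centroid X \<in> rel_frontier ?Q"
      using in_Q closure_subset by (auto simp: rel_frontier_def)
    then obtain F where F: "F facet_of ?Q" "centroid X \<in> F"
      using rel_frontier_of_polyhedron[OF poly] by blast
    obtain a b where ab: "?Q \<subseteq> {x. a \<bullet> x \<le> b}" "F = ?Q \<inter> {x. a \<bullet> x = b}"
      using facet_of_polyhedron[OF poly F(1)] by blast
    have le: "a \<bullet> X $ k \<le> b" for k using ab(1) row_in_conv_rows[of k UNIV X] by blast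
    have "real CARD('n) * (a \<bullet> centroid X) = (\<Sum>k\<in>UNIV. a \<bullet> X $ k)"
      by (simp add: centroid_def inner_sum_right)
    then have "(\<Sum>k\<in>UNIV. b - a \<bullet> X $ k) = 0"
      using F(2) ab(2) by (simp add: sum_subtractf)
    then have "\<forall>k\<in>UNIV. b - a \<bullet> X $ k = 0"
      using le by (subst (asm) sum_nonneg_eq_0_iff) auto
    then have "row_labels X F = UNIV"
      using row_in_conv_rows[of _ UNIV X] by (auto simp: row_labels_def ab(2))
    then show False
      using F(1) row_labels_eq_UNIV_iff[of F X] by (auto simp: facet_of_def)
  qed
  then show ?thesis using interior_rel_interior_gen[of ?Q] dim by simp
qed

text \<open>Takes a label set instead of a facet, so that the same \<open>L\<close> can be followed
  from one configuration to another.\<close>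

definition cone_rows :: "real ^ 'd ^ 'n \<Rightarrow> 'n set \<Rightarrow> (real ^ 'd) set" where
  "cone_rows X L = convex hull (insert (centroid X) ((\<lambda>k. X $ k) ` L))"

lemma cone_rows_facet:
  fixes X :: "real ^ 'd ^ 'n"
  assumes "F facet_of conv_rows X UNIV"
  shows "cone_rows X (row_labels X F) = convex hull (insert (centroid X) F)"
proof -
  have "F = convex hull ((\<lambda>k. X $ k) ` row_labels X F)"
    using face_eq_conv_rows[OF facet_of_imp_face_of[OF assms]] by (simp add: conv_rows_def)
  then show ?thesis unfolding cone_rows_def by (metis hull_insert)
qed

lemma facet_labels_cases:
  assumes "L \<in> facet_labels X"
  obtains F where "F facet_of conv_rows X UNIV" "L = row_labels X F"
  using assms unfolding facet_labels_def by blast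

lemma Union_cone_rows:
  fixes X :: "real ^ 'd ^ 'n"
  assumes dim: "aff_dim (conv_rows X UNIV) = int CARD('d)"
  shows "conv_rows X UNIV = (\<Union>L\<in>facet_labels X. cone_rows X L)"
proof -
  let ?A = "{F. F facet_of conv_rows X UNIV}"
  have "conv_rows X UNIV = (\<Union>F\<in>?A. convex hull (insert (centroid X) F))"
    by (rule polytope_eq_Union_cones[OF polytope_conv_rows centroid_in_interior[OF dim]])
  also have "\<dots> = (\<Union>F\<in>?A. cone_rows X (row_labels X F))"
    by (intro SUP_cong) (simp_all add: cone_rows_facet)
  also have "\<dots> = (\<Union>L\<in>facet_labels X. cone_rows X L)"
    unfolding facet_labels_def by blast
  finally show ?thesis .
qed

lemma compact_cone_rows: "compact (cone_rows X L)" for X :: "real ^ 'd ^ 'n"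
  unfolding cone_rows_def by (intro finite_imp_compact_convex_hull) simp

lemma set_integral_conv_rows:
  fixes X :: "real ^ 'd ^ 'n" and f :: "real ^ 'd \<Rightarrow> real"
  assumes dim: "aff_dim (conv_rows X UNIV) = int CARD('d)"
    and cont: "continuous_on UNIV f"
  shows "(LINT w:conv_rows X UNIV|lborel. f w) = (\<Sum>L\<in>facet_labels X. LINT w:cone_rows X L|lborel. f w)"
  unfolding Union_cone_rows[OF dim]
proof (rule set_integral_UN_negligible)
  show "pairwise (\<lambda>L M. negligible (cone_rows X L \<inter> cone_rows X M)) (facet_labels X)"
  proof (rule pairwiseI)
    fix L M assume L: "L \<in> facet_labels X" and M: "M \<in> facet_labels X" and "L \<noteq> M"
    obtain F where F: "F facet_of conv_rows X UNIV" "L = row_labels X F"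
      using L by (rule facet_labels_cases)
    obtain G where G: "G facet_of conv_rows X UNIV" "M = row_labels X G"
      using M by (rule facet_labels_cases)
    have "F \<noteq> G" using \<open>L \<noteq> M\<close> F(2) G(2) by blast
    then show "negligible (cone_rows X L \<inter> cone_rows X M)"
      unfolding F(2) G(2) cone_rows_facet[OF F(1)] cone_rows_facet[OF G(1)]
      by (rule negligible_cone_Int_cone[OF polytope_conv_rows centroid_in_interior[OF dim] F(1) G(1)])
  qed
qed (auto intro: compact_cone_rows continuous_on_subset[OF cont])

text \<open>The affine hull of a proper face misses the relative interior, so the centroid adds a
  dimension to the facet. This is what makes the determinants at \<open>X\<close> nonzero.\<close>

lemma vol_cone_rows_pos:
  fixes X :: "real ^ 'd ^ 'n"
  assumes dim: "aff_dim (conv_rows X UNIV) = int CARD('d)" and L: "L \<in> facet_labels X"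
  shows "vol (cone_rows X L) > 0"
proof -
  obtain F where F: "F facet_of conv_rows X UNIV" "L = row_labels X F"
    using L by (rule facet_labels_cases)
  have face: "F face_of conv_rows X UNIV" and "F \<noteq> conv_rows X UNIV"
    and dF: "aff_dim F = int CARD('d) - 1"
    using F(1) dim by (auto simp: facet_of_def)
  then have "affine hull F \<inter> rel_interior (conv_rows X UNIV) = {}"
    by (intro affine_hull_face_of_disjoint_rel_interior convex_conv_rows)
  then have "centroid X \<notin> affine hull F"
    using centroid_in_interior[OF dim] interior_subset_rel_interior by blast
  then have "aff_dim (cone_rows X L) = int CARD('d)"
    unfolding F(2) cone_rows_facet[OF F(1)] using dF by (simp add: aff_dim_convex_hull aff_dim_insert)
  then show ?thesis
    by (intro vol_pos_of_aff_dim compact_cone_rows) (simp add: cone_rows_def)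
qed

text \<open>Full dimension of a nearby configuration has to be proved; one cone of positive volume
  inside its hull suffices.\<close>

lemma aff_dim_of_vol_cone_rows:
  fixes X :: "real ^ 'd ^ 'n"
  assumes "vol (cone_rows X L) > 0"
  shows "aff_dim (conv_rows X UNIV) = int CARD('d)"
proof (rule ccontr)
  assume "\<not> ?thesis"
  then have "negligible (conv_rows X UNIV)"
    using aff_dim_le_DIM[of "conv_rows X UNIV"] by (intro negligible_convex_lowdim convex_conv_rows) simp
  moreover have "cone_rows X L \<subseteq> conv_rows X UNIV"
  proof -
    have "(\<Sum>k\<in>UNIV. (1 / real CARD('n)) *\<^sub>R X $ k) \<in> conv_rows X UNIV"
      by (rule convex_sum) (auto simp: convex_conv_rows row_in_conv_rows)
    then have "centroid X \<in> conv_rows X UNIV" by (simp add: centroid_def scaleR_right.sum)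
    then show ?thesis
      unfolding cone_rows_def by (intro hull_minimal convex_conv_rows) (auto simp: row_in_conv_rows)
  qed
  ultimately have "negligible (cone_rows X L)" by (rule negligible_subset)
  then have "measure lebesgue (cone_rows X L) = 0" by (rule negligible_imp_measure0)
  moreover have "measure lebesgue (cone_rows X L) = vol (cone_rows X L)"
    by (intro measure_completion) (auto intro: borel_compact compact_cone_rows)
  ultimately show False using assms by simp
qed

text \<open>A facet is a simplex of dimension d - 1 and has d vertices. They are the vertices of the
  polytope lying in the facet, and the rows list the vertices of the polytope without
  repetition.\<close>

lemma card_facet_labels:
  fixes X :: "real ^ 'd ^ 'n"
  assumes simp: "simplicial_polytope (conv_rows X UNIV)"
    and dim: "aff_dim (conv_rows X UNIV) = int CARD('d)"
    and ext: "bij_betw (\<lambda>k. X $ k) UNIV {v. v extreme_point_of conv_rows X UNIV}"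
    and L: "L \<in> facet_labels X"
  shows "card L = CARD('d)"
proof -
  obtain F where F: "F facet_of conv_rows X UNIV" "L = row_labels X F"
    using L by (rule facet_labels_cases)
  have face: "F face_of conv_rows X UNIV" using F(1) by (rule facet_of_imp_face_of)
  obtain C where C: "\<not> affine_dependent C" "int (card C) = int CARD('d)" "F = convex hull C"
    using simp F(1) dim by (auto simp: simplicial_polytope_def simplex_def)
  have "C = {v. v extreme_point_of F}"
    unfolding C(3) using extreme_point_of_convex_hull_affine_independent[OF C(1)] by blast
  also have "\<dots> = {v. v extreme_point_of conv_rows X UNIV} \<inter> F"
    using extreme_point_of_face[OF face] by blast
  also have "\<dots> = (\<lambda>k. X $ k) ` L"
    using bij_betw_imp_surj_on[OF ext] F(2) by (auto simp: row_labels_def)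
  finally have "card C = card L"
    using bij_betw_imp_inj_on[OF ext] by (simp add: card_image inj_on_subset)
  then show ?thesis using C(2) by simp
qed

section \<open>Moments as quotients of homogeneous polynomials\<close>

lemma set_integral_cone_rows:
  fixes X :: "real ^ 'd ^ 'n" and \<iota> :: "'e::{finite,wellorder} \<Rightarrow> 'd" and f :: "real ^ 'd \<Rightarrow> real"
  assumes "bij \<iota>" "bij_betw e (UNIV :: 'd set) L" "continuous_on UNIV f"
  shows "(LINT w:cone_rows X L|lborel. f w) =
    \<bar>det (\<chi> k i. (X $ e (\<iota> k) - centroid X) $ \<iota> i)\<bar> *
    (LINT x:std_simplex|lborel. f (centroid X + (\<Sum>k\<in>UNIV. x $ k *\<^sub>R (X $ e (\<iota> k) - centroid X))))"
proof -
  have "(\<lambda>k. X $ k) ` L = range (\<lambda>i. X $ e i)"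
    using bij_betw_imp_surj_on[OF assms(2)] by auto
  then show ?thesis
    unfolding cone_rows_def
    using set_integral_simplex[OF assms(1) continuous_on_subset[OF assms(3)], of "centroid X" "\<lambda>i. X $ e i"]
    by simp
qed

lemma homogeneous_family_centroid:
  "homogeneous_family 1 (\<lambda>_ X. centroid X $ l)"
  unfolding centroid_def vector_scaleR_component sum_component real_scaleR_def
  by (intro homogeneous_family_scale homogeneous_family_sum homogeneous_family_entry continuous_on_const)

lemma homogeneous_family_edge:
  "homogeneous_family 1 (\<lambda>_ X. (X $ k - centroid X) $ l)"
  unfolding vector_minus_component
  by (intro homogeneous_family_diff homogeneous_family_entry homogeneous_family_centroid)

lemma moments_rational:
  fixes X :: "real ^ 'd ^ 'n"
  assumes dim: "aff_dim (conv_rows X UNIV) = int CARD('d)"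
    and card: "\<And>L. L \<in> facet_labels X \<Longrightarrow> card L = CARD('d)"
  shows "\<exists>U V N. open U \<and> X \<in> U
            \<and> homogeneous_polynomial CARD('d) V
            \<and> (\<forall>I :: 'd \<Rightarrow> nat. homogeneous_polynomial ((\<Sum>l\<in>UNIV. I l) + CARD('d)) (N I))
            \<and> (\<forall>Y\<in>U. labeled_face_lattice Y = labeled_face_lattice X \<longrightarrow>
                  vol (conv_rows Y UNIV) = V Y
                \<and> (\<forall>I. moment (conv_rows Y UNIV) I = N I Y / V Y))"
proof -
  let ?\<F> = "facet_labels X"
  obtain \<iota> :: "'d wo \<Rightarrow> 'd" where \<iota>: "bij \<iota>" using ex_bij_wo by blast
  have "\<exists>e. bij_betw e (UNIV :: 'd set) L" if "L \<in> ?\<F>" for L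
    using card[OF that] by (intro finite_same_card_bij) simp_all
  then obtain e where e: "\<And>L. L \<in> ?\<F> \<Longrightarrow> bij_betw (e L) (UNIV :: 'd set) L" by metis
  \<comment> \<open>For each facet label set: the signed determinant of the edges from the centroid,
    of degree d in \<open>Y\<close>, and the integral of the monomial over the standard simplex, of
    degree |I|.\<close>
  define A where "A = (\<lambda>L (Y :: real ^ 'd ^ 'n). det (\<chi> k i. (Y $ e L (\<iota> k) - centroid Y) $ \<iota> i))"
  define B where "B = (\<lambda>I L (Y :: real ^ 'd ^ 'n). LINT x:std_simplex|lborel.
      \<Prod>l\<in>UNIV. (centroid Y + (\<Sum>k\<in>UNIV. x $ k *\<^sub>R (Y $ e L (\<iota> k) - centroid Y))) $ l ^ I l)"
  define N where "N = (\<lambda>I Y. \<Sum>L\<in>?\<F>. sgn (A L X) * (A L Y * B I L Y))"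
  define U where "U = (\<Inter>L\<in>?\<F>. {Y. 0 < sgn (A L X) * A L Y})"
  have int: "(LINT w:cone_rows Y L|lborel. \<Prod>l\<in>UNIV. (w $ l) ^ I l) = \<bar>A L Y\<bar> * B I L Y"
    if "L \<in> ?\<F>" for L Y I
    unfolding A_def B_def by (rule set_integral_cone_rows[OF \<iota> e[OF that]]) (intro continuous_intros)
  \<comment> \<open>The volume is the integral for the zero exponent, so
    \<open>N (\<lambda>_. 0)\<close> will serve as the denominator.\<close>
  have vol: "vol S = (LINT w:S|lborel. \<Prod>l\<in>UNIV. (w $ l) ^ (\<lambda>_. 0) l)" for S :: "(real ^ 'd) set"
    by (simp add: set_lebesgue_integral_def)
  have A: "homogeneous_polynomial CARD('d) (A L)" for L
  proof -
    have "homogeneous_family CARD('d wo) (\<lambda>(_::real) Y :: real ^ 'd ^ 'n. det (\<chi> k i. (Y $ e L (\<iota> k) - centroid Y) $ \<iota> i))"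
      by (intro homogeneous_family_det homogeneous_family_edge)
    then show ?thesis
      unfolding A_def card_wo by (rule homogeneous_polynomial_of_family)
  qed
  have B: "homogeneous_polynomial (\<Sum>l\<in>UNIV. I l) (B I L)" for I L
    unfolding B_def vector_add_component sum_component vector_scaleR_component real_scaleR_def
    by (intro homogeneous_polynomial_integral compact_std_simplex homogeneous_family_prod
        homogeneous_family_power homogeneous_family_add homogeneous_family_sum homogeneous_family_scale
        homogeneous_family_centroid homogeneous_family_edge continuous_intros finite)
  have N: "homogeneous_polynomial ((\<Sum>l\<in>UNIV. I l) + CARD('d)) (N I)" for I
  proof -
    have "homogeneous_family (CARD('d) + (\<Sum>l\<in>UNIV. I l)) (\<lambda>_::real. N I)"
      unfolding N_def
      by (intro homogeneous_family_sum homogeneous_family_scale homogeneous_family_mult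
          homogeneous_family_of_polynomial A B continuous_on_const)
    then show ?thesis unfolding add.commute[of _ "CARD('d)"] by (rule homogeneous_polynomial_of_family)
  qed
  have "open U"
    unfolding U_def
    by (intro open_INT ballI open_Collect_less continuous_intros homogeneous_polynomial_continuous[OF A]) simp_all
  moreover have "A L X \<noteq> 0" if "L \<in> ?\<F>" for L
    using vol_cone_rows_pos[OF dim that] unfolding vol int[OF that] by auto
  then have "X \<in> U"
    unfolding U_def by (auto simp: sgn_mult_self_eq abs_sgn[symmetric] mult.commute)
  moreover have "homogeneous_polynomial CARD('d) (N (\<lambda>_. 0))"
    using N[of "\<lambda>_. 0"] by simp
  moreover have "vol (conv_rows Y UNIV) = N (\<lambda>_. 0) Y \<and>
      (\<forall>I. moment (conv_rows Y UNIV) I = N I Y / N (\<lambda>_. 0) Y)"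
    if Y: "Y \<in> U" "labeled_face_lattice Y = labeled_face_lattice X" for Y
  proof -
    have "conv_rows X UNIV \<noteq> {}" using row_in_conv_rows[of _ UNIV X] by blast
    then obtain L where L: "L \<in> ?\<F>" using Union_cone_rows[OF dim] by auto
    have sgn: "sgn (A L X) * A L Y = \<bar>A L Y\<bar>" "A L Y \<noteq> 0" if "L \<in> ?\<F>" for L
      using Y(1) that by (auto simp: U_def sgn_if zero_less_mult_iff split: if_splits)
    have "vol (cone_rows X L) > 0" by (rule vol_cone_rows_pos[OF dim L])
    then have "B (\<lambda>_. 0) L X \<noteq> 0" unfolding vol int[OF L] by auto
    \<comment> \<open>For the zero exponent the integrand is 1, so the value is the same for every
      configuration and being nonzero passes from \<open>X\<close> to \<open>Y\<close>.\<close>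
    moreover have "B (\<lambda>_. 0) L X = B (\<lambda>_. 0) L Y" by (simp add: B_def)
    ultimately have "vol (cone_rows Y L) \<noteq> 0"
      using sgn(2)[OF L] unfolding vol int[OF L] by simp
    then have "vol (cone_rows Y L) > 0" by (simp add: zero_less_measure_iff)
    then have dimY: "aff_dim (conv_rows Y UNIV) = int CARD('d)" by (rule aff_dim_of_vol_cone_rows)
    \<comment> \<open>Full dimension is now known on both sides, so the facets of each are the
      maximal proper elements of one and the same lattice.\<close>
    have "facet_labels Y = ?\<F>"
      unfolding facet_labels_eq_maximal[OF dim] facet_labels_eq_maximal[OF dimY] Y(2) ..
    then have *: "(LINT w:conv_rows Y UNIV|lborel. \<Prod>l\<in>UNIV. (w $ l) ^ I l) = N I Y" for I
      unfolding N_def using int sgn(1)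
      by (subst set_integral_conv_rows[OF dimY]) (auto intro!: continuous_intros sum.cong simp flip: mult.assoc)
    then show ?thesis
      unfolding moment_eq[OF compact_conv_rows] vol * by simp
  qed
  ultimately show ?thesis using N
    by (intro exI[of _ U] exI[of _ "N (\<lambda>_. 0)"] exI[of _ N]) blast
qed

theorem theorem2p2:
  fixes P :: "(real ^ 'd) set" and X :: "real ^ 'd ^ 'n"
  assumes "simplicial_polytope P"
    and "aff_dim P = int CARD('d)"
    and "bij_betw (\<lambda>k. X $ k) UNIV {v. v extreme_point_of P}"
    and "CARD('n) \<ge> CARD('d) + 2"
  shows "(\<forall>\<Sigma>. triangulates X \<Sigma> P \<longrightarrow>
            (\<forall>\<^sub>F t in nhds 0. (normalized_mgf_term P t has_sum triangulation_sum X \<Sigma> P t) UNIV))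
       \<and> (\<forall>\<Sigma> \<Sigma>'. triangulates X \<Sigma> P \<longrightarrow> triangulates X \<Sigma>' P \<longrightarrow>
            (\<forall>t. (\<forall>k. (\<Sum>l\<in>UNIV. X $ k $ l * t $ l) \<noteq> 1) \<longrightarrow>
               triangulation_sum X \<Sigma> P t = triangulation_sum X \<Sigma>' P t))
       \<and> (\<exists>U V N. open U \<and> X \<in> U
            \<and> homogeneous_polynomial CARD('d) V
            \<and> (\<forall>I :: 'd \<Rightarrow> nat. homogeneous_polynomial ((\<Sum>l\<in>UNIV. I l) + CARD('d)) (N I))
            \<and> (\<forall>Y\<in>U. labeled_face_lattice Y = labeled_face_lattice X \<longrightarrow>
                  vol (conv_rows Y UNIV) = V Y
                \<and> (\<forall>I. moment (conv_rows Y UNIV) I = N I Y / V Y)))"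
proof (intro conjI allI impI)
  have poly: "polytope P" using assms(1) by (simp add: simplicial_polytope_def)
  then have P: "compact P" "convex P" by (simp_all add: polytope_imp_compact polytope_imp_convex)
  have vol: "vol P > 0" using P assms(2) by (rule vol_pos_of_aff_dim)
  have inj: "inj (\<lambda>k. X $ k)" using assms(3) by (rule bij_betw_imp_inj_on)
  have range: "range (\<lambda>k. X $ k) = {v. v extreme_point_of P}"
    using assms(3) by (rule bij_betw_imp_surj_on)
  then have rows: "X $ k \<in> P" for k by (auto simp: extreme_point_of_def)
  have hull: "conv_rows X UNIV = P"
    unfolding conv_rows_def range using Krein_Milman_Minkowski[OF P] ..
  show "\<forall>\<^sub>F t in nhds 0. (normalized_mgf_term P t has_sum triangulation_sum X \<Sigma> P t) UNIV"
    if "triangulates X \<Sigma> P" for \<Sigma>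
    using triangulates_has_sum[OF P(1) vol inj rows] by eventually_elim (use that in blast)
  show "triangulation_sum X \<Sigma> P t = triangulation_sum X \<Sigma>' P t"
    if "triangulates X \<Sigma> P" "triangulates X \<Sigma>' P" "\<forall>k. (\<Sum>l\<in>UNIV. X $ k $ l * t $ l) \<noteq> 1" for \<Sigma> \<Sigma>' t
    by (rule triangulation_sum_unique[OF P(1) vol inj rows that(1,2)])
       (use that(3) in \<open>simp add: inner_vec_def\<close>)
  have "card L = CARD('d)" if "L \<in> facet_labels X" for L
    using card_facet_labels[OF _ _ _ that] assms(1-3) by (simp add: hull)
  then show "\<exists>U V N. open U \<and> X \<in> U
            \<and> homogeneous_polynomial CARD('d) V
            \<and> (\<forall>I :: 'd \<Rightarrow> nat. homogeneous_polynomial ((\<Sum>l\<in>UNIV. I l) + CARD('d)) (N I))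
            \<and> (\<forall>Y\<in>U. labeled_face_lattice Y = labeled_face_lattice X \<longrightarrow>
                  vol (conv_rows Y UNIV) = V Y
                \<and> (\<forall>I. moment (conv_rows Y UNIV) I = N I Y / V Y))"
    using assms(2) by (intro moments_rational) (simp_all add: hull)
qed

end
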